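(* Let $F$ be a graph and let $G$ be an $F$-free connected graph on $n$ vertices. If $n$ is odd and $n>2n_F$, then $$\lambda_2(G)\le\rho^*\Big(\frac{n-1}{2},F\Big),$$ and equality holds if and only if $G\in\mathcal I\big(G^*(\tfrac{n-1}{2},F),G^*(\tfrac{n-1}{2},F)\big)$ and $G$ is $F$-free.
   Context: Graphs are finite and simple. $\lambda_1(G)\ge\lambda_2(G)\ge\cdots$ are the adjacency eigenvalues of $G$, and $\rho(G)=\lambda_1(G)$ is the spectral radius. $G$ is $F$-free if it contains no copy of $F$ as a (not necessarily induced) subgraph. For $n\ge n_F$, $\rho^*(n,F)$ is the maximum spectral radius among $F$-free graphs on $n$ vertices, and $G^*(n,F)$ denotes an extremal graph, i.e. an $F$-free graph on $n$ vertices with $\rho(G^*(n,F))=\rho^*(n,F)$ (if the extremal graph is not unique, each occurrence of $G^*(n,F)$ stands for some extremal graph). Here $n_F$ is a positive integer threshold depending on $F$, such that orders $n\ge n_F$ are considered (if $n_F=\infty$, conditions on $n$ are read as "$n$ sufficiently large"). For two disjoint graphs $A,B$, $\mathcal I(A,B)$ is the family of connected graphs obtained from the disjoint union of $A$ and $B$ by adding one new vertex and joining it to some vertices of $A$ and some vertices of $B$. *)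

theory Defs
  imports
    "Jordan_Normal_Form.Char_Poly"
    "Graph_Theory.Graph_Theory"
    "HOL-Library.Countable_Set"
    "HOL-Library.Multiset"
begin

text \<open>
  Finite simple graphs are the \<^locale>\<open>pair_graph\<close>s of \<open>Graph_Theory\<close>: finite, loop-free,
  symmetric digraphs whose arcs are pairs, so an edge \<open>uv\<close> is the pair of arcs \<open>(u,v)\<close>, \<open>(v,u)\<close>.
\<close>

text \<open>
  The rows are indexed through an arbitrary but fixed enumeration of the (finite) vertex set;
  another enumeration gives a permutation-similar matrix, hence the same eigenvalues.
\<close>

definition adj_mat :: "'a pair_pre_digraph \<Rightarrow> real mat" where
  "adj_mat G = mat (card (pverts G)) (card (pverts G))
     (\<lambda>(i, j). if (from_nat_into (pverts G) i, from_nat_into (pverts G) j) \<in> parcs G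
               then 1 else 0)"

text \<open>
  The eigenvalues in non-increasing order, with (algebraic) multiplicity.  For a graph the matrix
  is real symmetric, so the list has length \<open>card (pverts G)\<close>.
\<close>

definition adj_eigenvalues :: "'a pair_pre_digraph \<Rightarrow> real list" where
  "adj_eigenvalues G = rev (sorted_list_of_multiset (proots (char_poly (adj_mat G))))"

text \<open>Indices start at 1; the value is meaningful only for \<open>1 \<le> k \<le> card (pverts G)\<close>.\<close>

definition adj_eigenvalue :: "nat \<Rightarrow> 'a pair_pre_digraph \<Rightarrow> real" where
  "adj_eigenvalue k G = adj_eigenvalues G ! (k - 1)"

definition graph_spectral_radius :: "'a pair_pre_digraph \<Rightarrow> real" where
  "graph_spectral_radius G = adj_eigenvalue 1 G"

definition contains_copy :: "'b pair_pre_digraph \<Rightarrow> 'a pair_pre_digraph \<Rightarrow> bool" where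
  "contains_copy F G \<longleftrightarrow> (\<exists>f. inj_on f (pverts F) \<and> f ` pverts F \<subseteq> pverts G \<and>
     (\<forall>u v. (u, v) \<in> parcs F \<longrightarrow> (f u, f v) \<in> parcs G))"

definition free_of :: "'b pair_pre_digraph \<Rightarrow> 'a pair_pre_digraph \<Rightarrow> bool" where
  "free_of F G \<longleftrightarrow> \<not> contains_copy F G"

text \<open>
  Every finite graph has an isomorphic copy with vertices in \<^typ>\<open>nat\<close>, so it suffices to range
  over those.  The maximum is over a finite set of reals (there are finitely many 0/1 matrices of
  size \<open>m\<close>), which is nonempty whenever some \<open>F\<close>-free graph on \<open>m \<ge> 1\<close> vertices exists.
\<close>

definition max_spectral_radius :: "nat \<Rightarrow> 'b pair_pre_digraph \<Rightarrow> real" where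
  "max_spectral_radius m F = Max {graph_spectral_radius H | H :: nat pair_pre_digraph.
     pair_graph H \<and> card (pverts H) = m \<and> free_of F H}"

definition extremal_graph :: "nat \<Rightarrow> 'b pair_pre_digraph \<Rightarrow> 'a pair_pre_digraph \<Rightarrow> bool" where
  "extremal_graph m F H \<longleftrightarrow> pair_graph H \<and> card (pverts H) = m \<and> free_of F H \<and>
     graph_spectral_radius H = max_spectral_radius m F"

text \<open>
  Intended for vertex-disjoint graphs \<open>A\<close> and \<open>B\<close>.  The name \<open>connected\<close> also exists in topology,
  hence the qualified name.
\<close>

definition join_family ::
  "'a pair_pre_digraph \<Rightarrow> 'a pair_pre_digraph \<Rightarrow> 'a pair_pre_digraph set" where
  "join_family A B = {H. (\<exists>w S T. w \<notin> pverts A \<union> pverts B \<and> S \<subseteq> pverts A \<and> T \<subseteq> pverts B \<and>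
       pverts H = insert w (pverts A \<union> pverts B) \<and>
       parcs H = parcs A \<union> parcs B \<union> {w} \<times> (S \<union> T) \<union> (S \<union> T) \<times> {w}) \<and>
     Digraph_Component.connected (with_proj H)}"

end

theory Submission
  imports Defs "Jordan_Normal_Form.Schur_Decomposition"
begin

text \<open>
  Let \<open>m = (n - 1) / 2\<close> and let \<open>x\<close> be an eigenfunction for the second eigenvalue \<open>c\<close> that is
  orthogonal to the positive Perron vector, so that it takes both signs.  Restricting \<open>x\<close> to the
  set \<open>P\<close> of vertices where it is positive can only increase the Rayleigh quotient, and likewise for
  the set \<open>N\<close> where it is negative; one of the two sets has at most \<open>m\<close> vertices and therefore lies
  in an \<open>F\<close>-free induced subgraph of order \<open>m\<close>, which bounds \<open>c\<close>.  If equality holds, no edge joins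
  \<open>P\<close> and \<open>N\<close>, and both have exactly \<open>m\<close> vertices, as otherwise some adjacent zero of \<open>x\<close> could be
  added to raise the Rayleigh quotient further.  The one remaining vertex is the joining vertex.
  Conversely, if \<open>G\<close> joins two extremal graphs, a combination of their top eigenfunctions orthogonal
  to the top eigenfunction of \<open>G\<close> has Rayleigh quotient equal to the extremal radius.

  Subgraphs are padded by further vertices of \<open>G\<close> and not by isolated ones, since adding isolated
  vertices may destroy \<open>F\<close>-freeness when \<open>F\<close> itself has isolated vertices.
\<close>

section \<open>Orthogonal diagonalisation of real symmetric matrices\<close>

definition orthogonal_real_mat :: "nat \<Rightarrow> real mat \<Rightarrow> bool" where
  "orthogonal_real_mat n U \<longleftrightarrow> U \<in> carrier_mat n n \<and> U\<^sup>T * U = 1\<^sub>m n"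

lemma orthogonal_real_matD:
  assumes "orthogonal_real_mat n U"
  shows "U \<in> carrier_mat n n" "U\<^sup>T \<in> carrier_mat n n" "U\<^sup>T * U = 1\<^sub>m n" "U * U\<^sup>T = 1\<^sub>m n"
  using assms mat_mult_left_right_inverse[of "U\<^sup>T" n U] by (auto simp: orthogonal_real_mat_def)

text \<open>The Hermitian form of \<open>A\<close> at an eigenvector \<open>v\<close> is its own
  conjugate because \<open>A\<close> is real and symmetric, and it equals \<open>e\<close> times the
  squared norm \<open>s\<close> of \<open>v\<close>. As \<open>s\<close> is nonzero,
  \<open>e\<close> is its own conjugate.\<close>

lemma symmetric_real_eigenvalue_real:
  fixes A :: "real mat" and e :: complex
  assumes A: "A \<in> carrier_mat n n" and sym: "A\<^sup>T = A"
    and e: "eigenvalue (map_mat of_real A) e"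
  shows "e \<in> \<real>"
proof -
  let ?A = "map_mat complex_of_real A"
  obtain v where "eigenvector ?A v e" using e by (auto simp: eigenvalue_def)
  hence v: "v \<in> carrier_vec n" and v0: "v \<noteq> 0\<^sub>v n" and ev: "?A *\<^sub>v v = e \<cdot>\<^sub>v v"
    using A by (auto simp: eigenvector_def)
  have symij: "A $$ (i,j) = A $$ (j,i)" if "i < n" "j < n" for i j
    using arg_cong[OF sym, of "\<lambda>M. M $$ (j,i)"] A that by simp
  have row: "(\<Sum>j<n. of_real (A $$ (i,j)) * v $ j) = e * v $ i" if "i < n" for i
    using arg_cong[OF ev, of "\<lambda>w. w $ i"] A v that
    by (simp add: scalar_prod_def atLeast0LessThan)
  define q where "q = (\<Sum>i<n. \<Sum>j<n. cnj (v $ i) * of_real (A $$ (i,j)) * v $ j)"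
  define s where "s = (\<Sum>i<n. (cmod (v $ i))\<^sup>2)"
  have qe: "q = e * of_real s"
  proof -
    have "q = (\<Sum>i<n. cnj (v $ i) * (\<Sum>j<n. of_real (A $$ (i,j)) * v $ j))"
      unfolding q_def by (simp add: sum_distrib_left mult.assoc)
    also have "\<dots> = (\<Sum>i<n. e * (v $ i * cnj (v $ i)))"
      by (intro sum.cong refl) (simp add: row)
    finally show ?thesis
      unfolding s_def by (simp add: complex_norm_square sum_distrib_left del: of_real_power)
  qed
  have "cnj q = (\<Sum>i<n. \<Sum>j<n. v $ i * of_real (A $$ (i,j)) * cnj (v $ j))"
    unfolding q_def by simp
  also have "\<dots> = (\<Sum>j<n. \<Sum>i<n. v $ i * of_real (A $$ (i,j)) * cnj (v $ j))"
    by (rule sum.swap)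
  also have "\<dots> = q"
    unfolding q_def by (intro sum.cong refl) (simp add: symij mult_ac)
  finally have "cnj e * of_real s = e * of_real s" using qe by simp
  moreover have "s \<noteq> 0"
  proof
    assume "s = 0"
    hence "\<forall>i<n. v $ i = 0" unfolding s_def by (subst (asm) sum_nonneg_eq_0_iff) auto
    with v v0 show False by auto
  qed
  ultimately have "cnj e = e" by simp
  thus ?thesis by (simp add: Reals_cnj_iff)
qed

text \<open>Over the complex numbers the polynomial splits and all its roots are real, so the
  factorisation is the image of a real one under an injective map.\<close>

lemma symmetric_real_char_poly_splits:
  fixes A :: "real mat"
  assumes A: "A \<in> carrier_mat n n" and sym: "A\<^sup>T = A"
  shows "\<exists>es. char_poly A = (\<Prod>e\<leftarrow>es. [:- e, 1:])"
proof -
  interpret h: map_poly_inj_idom_hom "of_real :: real \<Rightarrow> complex" ..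
  let ?A = "map_mat complex_of_real A"
  have A': "?A \<in> carrier_mat n n" using A by simp
  obtain as where as: "char_poly ?A = (\<Prod>a\<leftarrow>as. [:- a, 1:])"
    using char_poly_factorized[OF A'] by blast
  have re: "of_real (Re a) = a" if "a \<in> set as" for a
  proof -
    have "poly (char_poly ?A) a = 0"
      unfolding as using that by (auto simp: poly_prod_list)
    hence "eigenvalue ?A a" using eigenvalue_root_char_poly[OF A'] by simp
    thus ?thesis using symmetric_real_eigenvalue_real[OF A sym] by simp
  qed
  have "map_poly complex_of_real (char_poly A) = (\<Prod>a\<leftarrow>as. [:- a, 1:])"
    using of_real_hom.char_poly_hom[OF A, where 'a = complex] as by simp
  also have "\<dots> = (\<Prod>a\<leftarrow>as. map_poly complex_of_real [:- Re a, 1:])"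
    by (intro arg_cong[where f = prod_list] map_cong refl) (simp add: re)
  also have "\<dots> = map_poly complex_of_real (\<Prod>e\<leftarrow>map Re as. [:- e, 1:])"
    by (simp add: h.hom_prod_list o_def)
  finally have "char_poly A = (\<Prod>e\<leftarrow>map Re as. [:- e, 1:])" by (simp only: h.eq_iff)
  thus ?thesis by blast
qed

text \<open>The Householder reflection exchanging \<open>v\<close> and the first unit vector.\<close>

lemma orthogonal_with_first_column:
  fixes v :: "real vec"
  assumes v: "v \<in> carrier_vec n" and n: "0 < n" and unit: "v \<bullet> v = 1"
  shows "\<exists>W. orthogonal_real_mat n W \<and> col W 0 = v"
proof -
  define w where "w i = v $ i - (if i = 0 then 1 else 0)" for i
  define s where "s = (\<Sum>k<n. w k * w k)"
  \<comment> \<open>\<open>W\<close> reflects in the hyperplane orthogonal to \<open>v\<close> minus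
    the first unit vector, and \<open>s\<close> is the squared length of that difference. If
    \<open>s = 0\<close>, division by zero gives \<open>c = 0\<close> and \<open>W\<close> is the
    identity, which is right since \<open>v\<close> is then the first unit vector.\<close>
  define c where "c = 2 / s"
  define W where "W = mat n n (\<lambda>(i,j). (if i = j then 1 else 0) - c * w i * w j)"
  have v1: "(\<Sum>k<n. v $ k * v $ k) = 1"
    using unit v by (simp add: scalar_prod_def atLeast0LessThan)
  have s: "s = 2 - 2 * v $ 0"
  proof -
    have "s = (\<Sum>k<n. v $ k * v $ k + (if k = 0 then 1 - 2 * v $ k else 0))"
      unfolding s_def w_def by (intro sum.cong refl) (auto simp: algebra_simps)
    also have "\<dots> = 2 - 2 * v $ 0"
      using n v1 by (simp add: sum.distrib)
    finally show ?thesis .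
  qed
  have w0: "w k = 0" if "s = 0" "k < n" for k
    using that unfolding s_def by (subst (asm) sum_nonneg_eq_0_iff) auto
  have "W\<^sup>T * W = 1\<^sub>m n"
  proof (rule eq_matI)
    fix i j assume "i < dim_row (1\<^sub>m n)" "j < dim_col (1\<^sub>m n)"
    hence ij: "i < n" "j < n" by auto
    have "(W\<^sup>T * W) $$ (i,j) =
      (\<Sum>k<n. ((if k = i then 1 else 0) - c * w k * w i) * ((if k = j then 1 else 0) - c * w k * w j))"
      using ij by (simp add: W_def scalar_prod_def atLeast0LessThan)
    also have "\<dots> = (\<Sum>k<n. (if k = i then (if i = j then 1 else 0) else 0)
        - (if k = i then c * w i * w j else 0) - (if k = j then c * w i * w j else 0)
        + c * c * w i * w j * (w k * w k))"
      by (intro sum.cong refl) (auto simp: algebra_simps)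
    also have "\<dots> = (if i = j then 1 else 0) - 2 * c * w i * w j + c * c * w i * w j * s"
      unfolding s_def using ij
      by (simp add: sum.distrib sum_subtractf sum_distrib_left)
    also have "\<dots> = (if i = j then 1 else 0)"
      using w0 ij by (cases "s = 0") (auto simp: c_def)
    finally show "(W\<^sup>T * W) $$ (i,j) = 1\<^sub>m n $$ (i,j)" using ij by simp
  qed (auto simp: W_def)
  hence "orthogonal_real_mat n W" by (auto simp: orthogonal_real_mat_def W_def)
  moreover have "col W 0 = v"
  proof (rule eq_vecI)
    fix i assume "i < dim_vec v"
    hence i: "i < n" using v by simp
    have "c * w 0 * w i = - w i"
    proof (cases "s = 0")
      case False
      hence "c * w 0 = -1" unfolding c_def using s by (simp add: w_def field_simps)
      thus ?thesis by simp
    qed (use w0 i in auto)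
    hence "col W 0 $ i = (if i = 0 then 1 else 0) + w i"
      using i n by (simp add: W_def mult_ac)
    thus "col W 0 $ i = v $ i" by (simp add: w_def)
  qed (use v in \<open>simp add: W_def\<close>)
  ultimately show ?thesis by blast
qed

text \<open>Deflation: a unit eigenvector for the head of \<open>es\<close> becomes the first column
  of an orthogonal matrix, and the induction continues with the remaining block. The diagonal
  follows the order of the given list, so a sorted list later fixes which column belongs to which
  eigenvalue.\<close>

lemma symmetric_real_diagonalizable:
  fixes A :: "real mat"
  assumes "A \<in> carrier_mat n n" and "A\<^sup>T = A" and "char_poly A = (\<Prod>e\<leftarrow>es. [:- e, 1:])"
  shows "\<exists>U. orthogonal_real_mat n U \<and> U\<^sup>T * A * U = mat_diag n (\<lambda>i. es ! i)"
  using assms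
proof (induction es arbitrary: n A)
  case Nil
  with degree_monic_char_poly[of A n] have "n = 0" by simp
  with Nil show ?case
    by (intro exI[of _ "1\<^sub>m 0"]) (auto simp: orthogonal_real_mat_def mat_diag_def)
next
  case (Cons e es)
  note A = Cons.prems(1)
  have cp: "char_poly A = [:- e, 1:] * (\<Prod>e\<leftarrow>es. [:- e, 1:])" using Cons.prems(3) by simp
  have "eigenvalue A e" unfolding eigenvalue_root_char_poly[OF A] cp by simp
  then obtain u where u: "u \<in> carrier_vec n" "u \<noteq> 0\<^sub>v n" "A *\<^sub>v u = e \<cdot>\<^sub>v u"
    using A by (auto simp: eigenvalue_def eigenvector_def)
  have uu: "u \<bullet> u > 0" using conjugate_square_greater_0_vec[OF u(1)] u(2) by simp
  define v where "v = (1 / sqrt (u \<bullet> u)) \<cdot>\<^sub>v u"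
  have v: "v \<in> carrier_vec n" "A *\<^sub>v v = e \<cdot>\<^sub>v v"
    using u A by (auto simp: v_def mult_mat_vec smult_smult_assoc mult.commute)
  have vv: "v \<bullet> v = 1"
    using uu u(1) by (simp add: v_def)
  have "0 < n" using u by (cases n) auto
  then obtain m where n: "n = Suc m" by (cases n) auto
  obtain W where W: "orthogonal_real_mat n W" "col W 0 = v"
    using orthogonal_with_first_column[OF v(1) \<open>0 < n\<close> vv] by blast
  note Wc = orthogonal_real_matD[OF W(1)]
  define A' where "A' = W\<^sup>T * A * W"
  have A': "A' \<in> carrier_mat n n" using A Wc by (auto simp: A'_def)
  have symA': "A'\<^sup>T = A'"
    using A Wc Cons.prems(2)
    by (simp add: A'_def transpose_mult[of _ n n _ n] assoc_mult_mat[of _ n n _ n _ n])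
  \<comment> \<open>The first column of \<open>W\<close> is an eigenvector and the columns are
    orthonormal, so the first column of \<open>A'\<close> is \<open>e\<close> times the first unit
    vector. Symmetry gives the same for the first row, and \<open>A'\<close> splits into
    blocks.\<close>
  have col0: "A' $$ (i,0) = (if i = 0 then e else 0)" if i: "i < n" for i
  proof -
    have "A' $$ (i,0) = (W\<^sup>T * (A * W)) $$ (i,0)"
      using A Wc by (simp add: A'_def)
    also have "\<dots> = col W i \<bullet> col (A * W) 0"
      using i A Wc \<open>0 < n\<close> by (subst index_mult_mat) auto
    also have "col (A * W) 0 = e \<cdot>\<^sub>v col W 0"
      unfolding col_mult2[OF A Wc(1) \<open>0 < n\<close>] W(2) by (rule v(2))
    also have "col W i \<bullet> (e \<cdot>\<^sub>v col W 0) = e * (col W i \<bullet> col W 0)"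
      using Wc i \<open>0 < n\<close> by simp
    also have "col W i \<bullet> col W 0 = (W\<^sup>T * W) $$ (i,0)"
      using Wc(1) i \<open>0 < n\<close> by (subst index_mult_mat) auto
    finally show ?thesis using Wc(3) i \<open>0 < n\<close> by simp
  qed
  have row0: "A' $$ (0,i) = (if i = 0 then e else 0)" if i: "i < n" for i
    using arg_cong[OF symA', of "\<lambda>M. M $$ (0,i)"] col0[OF i] A' i \<open>0 < n\<close> by simp
  define A3 where "A3 = mat m m (\<lambda>(i,j). A' $$ (Suc i, Suc j))"
  define A1 where "A1 = mat 1 1 (\<lambda>_. e)"
  have A1: "A1 \<in> carrier_mat 1 1" and A3: "A3 \<in> carrier_mat m m" by (auto simp: A1_def A3_def)
  have block: "A' = four_block_mat A1 (0\<^sub>m 1 m) (0\<^sub>m m 1) A3"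
  proof (rule eq_matI)
    fix i j
    assume "i < dim_row (four_block_mat A1 (0\<^sub>m 1 m) (0\<^sub>m m 1) A3)"
      "j < dim_col (four_block_mat A1 (0\<^sub>m 1 m) (0\<^sub>m m 1) A3)"
    hence "i < Suc m" "j < Suc m" by (auto simp: A1_def A3_def)
    thus "A' $$ (i,j) = four_block_mat A1 (0\<^sub>m 1 m) (0\<^sub>m m 1) A3 $$ (i,j)"
      using col0[of i] row0[of j] n by (auto simp: A1_def A3_def)
  qed (use A' n in \<open>auto simp: A1_def A3_def\<close>)
  have symA3: "A3\<^sup>T = A3"
  proof (rule eq_matI)
    fix i j assume "i < dim_row A3" "j < dim_col A3"
    hence ij: "i < m" "j < m" by (auto simp: A3_def)
    thus "A3\<^sup>T $$ (i,j) = A3 $$ (i,j)"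
      using arg_cong[OF symA', of "\<lambda>M. M $$ (Suc i, Suc j)"] A' n by (simp add: A3_def)
  qed (auto simp: A3_def)
  \<comment> \<open>Similarity keeps the characteristic polynomial; cancelling the factor of the
    block \<open>A1\<close> leaves the roots \<open>es\<close> for \<open>A3\<close>, as the
    induction hypothesis demands.\<close>
  have "similar_mat_wit A' A (W\<^sup>T) W"
    by (rule similar_mat_witI[of _ _ n]) (use A A' Wc in \<open>auto simp: A'_def\<close>)
  hence "char_poly A' = char_poly A"
    by (intro char_poly_similar) (auto simp: similar_mat_def)
  also have "char_poly A' = char_poly A1 * char_poly A3"
    unfolding block by (rule char_poly_four_block_zeros_col[OF A1 _ A3]) simp
  also have "char_poly A1 = [:- e, 1:]"
    by (simp add: A1_def char_poly_defs det_def sign_def)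
  finally have "[:- e, 1:] * char_poly A3 = [:- e, 1:] * (\<Prod>e\<leftarrow>es. [:- e, 1:])"
    using cp by simp
  hence "char_poly A3 = (\<Prod>e\<leftarrow>es. [:- e, 1:])"
    by (metis mult_cancel_left pCons_eq_0_iff zero_neq_one)
  from Cons.IH[OF A3 symA3 this] obtain U3
    where U3: "orthogonal_real_mat m U3" "U3\<^sup>T * A3 * U3 = mat_diag m (\<lambda>i. es ! i)" by blast
  note U3c = orthogonal_real_matD[OF U3(1)]
  define V where "V = four_block_mat (1\<^sub>m 1) (0\<^sub>m 1 m) (0\<^sub>m m 1) U3"
  have V: "V \<in> carrier_mat n n" using U3c n by (auto simp: V_def)
  have VT: "V\<^sup>T = four_block_mat (1\<^sub>m 1) (0\<^sub>m 1 m) (0\<^sub>m m 1) (U3\<^sup>T)"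
    unfolding V_def using U3c by (subst transpose_four_block_mat) auto
  have VV: "V\<^sup>T * V = 1\<^sub>m n"
    unfolding VT unfolding V_def using U3c n
    by (subst mult_four_block_mat[of _ 1 1 _ m _ m _ _ 1 _ m]) auto
  have VAV: "V\<^sup>T * A' * V = four_block_mat A1 (0\<^sub>m 1 m) (0\<^sub>m m 1) (U3\<^sup>T * A3 * U3)"
    unfolding VT unfolding V_def block using U3c A1 A3
    by (subst mult_four_block_mat[of _ 1 1 _ m _ m _ _ 1 _ m], auto)
       (subst mult_four_block_mat[of _ 1 1 _ m _ m _ _ 1 _ m], auto)
  have diag: "four_block_mat A1 (0\<^sub>m 1 m) (0\<^sub>m m 1) (mat_diag m (\<lambda>i. es ! i))
      = mat_diag n (\<lambda>i. (e # es) ! i)"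
    by (rule eq_matI) (auto simp: A1_def mat_diag_def n nth_Cons')
  show ?case
  proof (intro exI conjI)
    have WV: "(W * V)\<^sup>T = V\<^sup>T * W\<^sup>T" using Wc V by (simp add: transpose_mult)
    have VTc: "V\<^sup>T \<in> carrier_mat n n" using V by simp
    have "W\<^sup>T * (W * V) = V"
      using Wc V by (simp add: assoc_mult_mat[of _ n n _ n _ n, symmetric])
    hence "(W * V)\<^sup>T * (W * V) = V\<^sup>T * V"
      unfolding WV using Wc V VTc by (simp add: assoc_mult_mat[of _ n n _ n _ n])
    thus "orthogonal_real_mat n (W * V)"
      using Wc V VV VTc by (simp add: orthogonal_real_mat_def)
    have "(W * V)\<^sup>T * A * (W * V) = V\<^sup>T * A' * V"
      unfolding WV A'_def using Wc V VTc A by (simp add: assoc_mult_mat[of _ n n _ n _ n])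
    thus "(W * V)\<^sup>T * A * (W * V) = mat_diag n (\<lambda>i. (e # es) ! i)"
      using VAV U3(2) diag by simp
  qed
qed

section \<open>Eigenfunctions and the Rayleigh quotient\<close>

definition inner_on :: "'a set \<Rightarrow> ('a \<Rightarrow> real) \<Rightarrow> ('a \<Rightarrow> real) \<Rightarrow> real" where
  "inner_on V f g = (\<Sum>v\<in>V. f v * g v)"

text \<open>The adjacency operator. Acting on functions on the vertices instead of coordinate
  vectors spares most later arguments an enumeration of the vertices.\<close>

definition adj_apply :: "'a pair_pre_digraph \<Rightarrow> ('a \<Rightarrow> real) \<Rightarrow> 'a \<Rightarrow> real" where
  "adj_apply G f u = (\<Sum>v\<in>pverts G. of_bool ((u, v) \<in> parcs G) * f v)"

definition adj_form :: "'a pair_pre_digraph \<Rightarrow> ('a \<Rightarrow> real) \<Rightarrow> real" where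
  "adj_form G f = inner_on (pverts G) f (adj_apply G f)"

lemma inner_on_commute: "inner_on V f g = inner_on V g f"
  by (simp add: inner_on_def mult.commute)

lemma inner_on_add_left: "inner_on V (\<lambda>v. f v + g v) h = inner_on V f h + inner_on V g h"
  by (simp add: inner_on_def sum.distrib algebra_simps)

lemma inner_on_scale_left: "inner_on V (\<lambda>v. c * f v) g = c * inner_on V f g"
  by (simp add: inner_on_def sum_distrib_left mult.assoc)

lemma inner_on_add_right: "inner_on V h (\<lambda>v. f v + g v) = inner_on V h f + inner_on V h g"
  by (simp add: inner_on_def sum.distrib algebra_simps)

lemma inner_on_scale_right: "inner_on V g (\<lambda>v. c * f v) = c * inner_on V g f"
  by (simp add: inner_on_def sum_distrib_left mult_ac)

lemmas inner_on_linear = inner_on_add_left inner_on_add_right inner_on_scale_left inner_on_scale_right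

lemma inner_on_cong: "(\<And>v. v \<in> V \<Longrightarrow> f v = f' v) \<Longrightarrow> (\<And>v. v \<in> V \<Longrightarrow> g v = g' v) \<Longrightarrow> inner_on V f g = inner_on V f' g'"
  by (simp add: inner_on_def)

lemma inner_on_self_nonneg: "inner_on V f f \<ge> 0"
  by (simp add: inner_on_def sum_nonneg)

lemma inner_on_self_pos: "finite V \<Longrightarrow> v \<in> V \<Longrightarrow> f v \<noteq> 0 \<Longrightarrow> inner_on V f f > 0"
  unfolding inner_on_def by (rule sum_pos2) (auto simp: zero_less_mult_iff)

lemma inner_on_self_neq_zeroE:
  assumes "inner_on V f f \<noteq> 0"
  obtains v where "v \<in> V" "f v \<noteq> 0"
proof -
  have "\<not> (\<forall>v\<in>V. f v * f v = 0)" using assms unfolding inner_on_def by (metis (no_types) sum.neutral)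
  thus ?thesis using that by auto
qed

lemma adj_apply_add: "adj_apply G (\<lambda>v. f v + g v) u = adj_apply G f u + adj_apply G g u"
  by (simp add: adj_apply_def sum.distrib algebra_simps)

lemma adj_apply_scale: "adj_apply G (\<lambda>v. c * f v) u = c * adj_apply G f u"
  by (simp add: adj_apply_def sum_distrib_left mult_ac)

lemma adj_apply_sum:
  "adj_apply G (\<lambda>v. \<Sum>i\<in>I. f i v) u = (\<Sum>i\<in>I. adj_apply G (f i) u)"
  unfolding adj_apply_def sum_distrib_left by (rule sum.swap)

lemma adj_apply_cong: "(\<And>v. v \<in> pverts G \<Longrightarrow> f v = g v) \<Longrightarrow> adj_apply G f u = adj_apply G g u"
  by (simp add: adj_apply_def)

lemma adj_apply_nonneg: "(\<And>v. v \<in> pverts G \<Longrightarrow> f v \<ge> 0) \<Longrightarrow> adj_apply G f u \<ge> 0"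
  unfolding adj_apply_def by (intro sum_nonneg) simp

lemma adj_form_altdef:
  "adj_form G f = (\<Sum>u\<in>pverts G. \<Sum>v\<in>pverts G. of_bool ((u, v) \<in> parcs G) * f u * f v)"
  by (simp add: adj_form_def inner_on_def adj_apply_def sum_distrib_left mult_ac)

lemma pair_graph_finite: "pair_graph G \<Longrightarrow> finite (pverts G)"
  by (rule pair_fin_digraph.pair_finite_verts) (simp add: pair_graph_def pair_digraph_def)

lemma pair_graph_sym: "pair_graph G \<Longrightarrow> (u, v) \<in> parcs G \<longleftrightarrow> (v, u) \<in> parcs G"
  using pair_sym_digraph.arcs_symmetric[of G] 
  by (auto simp: pair_graph_def pair_pseudo_graph_def)

lemma pair_graph_arcD:
  "pair_graph G \<Longrightarrow> (u, v) \<in> parcs G \<Longrightarrow> u \<in> pverts G"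
  "pair_graph G \<Longrightarrow> (u, v) \<in> parcs G \<Longrightarrow> v \<in> pverts G"
  using pair_wf_digraph.in_arcsD1[of G u v] pair_wf_digraph.in_arcsD2[of G u v]
  by (auto simp: pair_graph_def pair_digraph_def pair_fin_digraph_def)

lemma pair_graph_no_loop: "pair_graph G \<Longrightarrow> (u, u) \<notin> parcs G"
  using pair_loopfree_digraph.pair_no_loops[of G "(u, u)"]
  by (auto simp: pair_graph_def pair_digraph_def)

lemma pair_graphI:
  assumes "finite (pverts G)" "parcs G \<subseteq> pverts G \<times> pverts G" "sym (parcs G)" "irrefl (parcs G)"
  shows "pair_graph G"
proof
  show "finite (parcs G)" using assms(1,2) by (meson finite_SigmaI finite_subset)
qed (use assms in \<open>auto simp: symmetric_def irrefl_def\<close>)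

lemma adj_apply_self_adjoint:
  assumes "pair_graph G"
  shows "inner_on (pverts G) f (adj_apply G g) = inner_on (pverts G) (adj_apply G f) g"
proof -
  have "inner_on (pverts G) f (adj_apply G g)
      = (\<Sum>u\<in>pverts G. \<Sum>v\<in>pverts G. of_bool ((u, v) \<in> parcs G) * f u * g v)"
    by (simp add: inner_on_def adj_apply_def sum_distrib_left mult_ac)
  also have "\<dots> = (\<Sum>v\<in>pverts G. \<Sum>u\<in>pverts G. of_bool ((u, v) \<in> parcs G) * f u * g v)"
    by (rule sum.swap)
  also have "\<dots> = (\<Sum>v\<in>pverts G. \<Sum>u\<in>pverts G. of_bool ((v, u) \<in> parcs G) * f u * g v)"
    by (intro sum.cong refl arg_cong2[where f = "(*)"] arg_cong[where f = of_bool] pair_graph_sym[OF assms])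
  also have "\<dots> = inner_on (pverts G) (adj_apply G f) g"
    by (simp add: inner_on_def adj_apply_def sum_distrib_right)
  finally show ?thesis .
qed

section \<open>Spectrum of the adjacency matrix\<close>

lemma adj_mat_carrier: "adj_mat G \<in> carrier_mat (card (pverts G)) (card (pverts G))"
  by (simp add: adj_mat_def)

lemma adj_mat_symmetric: "pair_graph G \<Longrightarrow> (adj_mat G)\<^sup>T = adj_mat G"
  by (rule eq_matI) (auto simp: adj_mat_def dest: pair_graph_sym[THEN iffD1, rotated])

text \<open>As the characteristic polynomial splits, the multiset of its real roots loses nothing,
  and sorting it only permutes the linear factors.\<close>

lemma char_poly_adj_mat:
  assumes "pair_graph G"
  shows "char_poly (adj_mat G) = (\<Prod>e\<leftarrow>adj_eigenvalues G. [:- e, 1:])"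
    and "length (adj_eigenvalues G) = card (pverts G)"
proof -
  obtain es where es: "char_poly (adj_mat G) = (\<Prod>e\<leftarrow>es. [:- e, 1:])"
    using symmetric_real_char_poly_splits[OF adj_mat_carrier adj_mat_symmetric[OF assms]] by blast
  have "proots (char_poly (adj_mat G)) = mset es"
    unfolding es
  proof (induction es)
    case (Cons e es)
    have "(\<Prod>e\<leftarrow>es. [:- e, 1:]) \<noteq> 0" by auto
    hence "proots ([:- e, 1:] * (\<Prod>e\<leftarrow>es. [:- e, 1:])) = proots [:- e, 1:] + mset es"
      using Cons by (subst proots_mult) auto
    thus ?case by (simp del: mult_pCons_left)
  qed simp
  hence m: "mset (adj_eigenvalues G) = mset es" by (simp add: adj_eigenvalues_def)
  hence "mset (map (\<lambda>e. [:- e, 1:]) (adj_eigenvalues G)) = mset (map (\<lambda>e. [:- e, 1:]) es)"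
    by simp
  thus "char_poly (adj_mat G) = (\<Prod>e\<leftarrow>adj_eigenvalues G. [:- e, 1:])"
    unfolding es by (metis prod_mset_prod_list)
  have "degree (\<Prod>e\<leftarrow>es. [:- e, 1:]) = length es"
    by (subst degree_prod_list_eq) (auto simp: o_def sum_list_triv)
  hence "length es = card (pverts G)"
    using degree_monic_char_poly[OF adj_mat_carrier, of G] es by simp
  thus "length (adj_eigenvalues G) = card (pverts G)"
    using m by (metis size_mset)
qed

lemma adj_eigenvalue_antimono:
  assumes "pair_graph G" "i \<le> j" "j < card (pverts G)"
  shows "adj_eigenvalue (Suc j) G \<le> adj_eigenvalue (Suc i) G"
proof -
  have "sorted (rev (adj_eigenvalues G))" by (simp add: adj_eigenvalues_def)
  thus ?thesis
    using assms char_poly_adj_mat(2)[OF assms(1)]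
    by (simp add: adj_eigenvalue_def sorted_rev_nth_mono)
qed

text \<open>\<open>orth\<close> and \<open>complete\<close> are the column and row identities of an
  orthogonal matrix with columns \<open>\<phi> i\<close>; the second yields expansions without any
  dimension argument. The functions are numbered from 0 but the eigenvalues from 1, hence
  \<open>Suc i\<close>.\<close>

locale adj_eigenbasis =
  fixes G :: "'a pair_pre_digraph" and \<phi> :: "nat \<Rightarrow> 'a \<Rightarrow> real"
  assumes graph: "pair_graph G"
    and orth: "i < card (pverts G) \<Longrightarrow> j < card (pverts G) \<Longrightarrow>
      inner_on (pverts G) (\<phi> i) (\<phi> j) = of_bool (i = j)"
    and complete: "u \<in> pverts G \<Longrightarrow> v \<in> pverts G \<Longrightarrow>
      (\<Sum>i<card (pverts G). \<phi> i u * \<phi> i v) = of_bool (u = v)"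
    and eigen: "i < card (pverts G) \<Longrightarrow> u \<in> pverts G \<Longrightarrow>
      adj_apply G (\<phi> i) u = adj_eigenvalue (Suc i) G * \<phi> i u"

lemma adj_eigenbasis_exists:
  assumes G: "pair_graph G"
  obtains \<phi> where "adj_eigenbasis G \<phi>"
proof -
  define V where "V = pverts G"
  define n where "n = card V"
  define a where "a = from_nat_into V"
  define idx where "idx = the_inv_into {..<n} a"
  have "finite V" using pair_graph_finite[OF G] by (simp add: V_def)
  hence bij: "bij_betw a {..<n} V"
    unfolding a_def n_def by (rule bij_betw_from_nat_into_finite)
  have idx: "idx (a k) = k" if "k < n" for k
    unfolding idx_def using bij that by (intro the_inv_into_f_f) (auto simp: bij_betw_def)
  have V: "\<exists>k<n. v = a k" if "v \<in> V" for v
    using bij that by (auto simp: bij_betw_def)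
  have reindex: "(\<Sum>v\<in>V. h v) = (\<Sum>k<n. h (a k))" for h :: "'a \<Rightarrow> real"
    using sum.reindex_bij_betw[OF bij] by metis
  obtain U where U: "orthogonal_real_mat n U"
      "U\<^sup>T * adj_mat G * U = mat_diag n (\<lambda>i. adj_eigenvalues G ! i)"
    using symmetric_real_diagonalizable[OF adj_mat_carrier adj_mat_symmetric char_poly_adj_mat(1)] G
    unfolding n_def V_def by blast
  note Uc = orthogonal_real_matD[OF U(1)]
  have A: "adj_mat G \<in> carrier_mat n n" using adj_mat_carrier[of G] by (simp add: n_def V_def)
  \<comment> \<open>Multiplying the diagonalisation by \<open>U\<close> from the left, where
    \<open>U\<close> times its transpose is the identity, shows that the columns of \<open>U\<close>
    are eigenvectors.\<close>
  have "adj_mat G * U = U * U\<^sup>T * (adj_mat G * U)" using Uc A by simp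
  also have "\<dots> = U * (U\<^sup>T * (adj_mat G * U))" using Uc(1,2) A by (intro assoc_mult_mat) auto
  also have "\<dots> = U * (U\<^sup>T * adj_mat G * U)"
    using Uc A by (simp add: assoc_mult_mat[of _ n n _ n _ n])
  also have "\<dots> = mat n n (\<lambda>(i,j). U $$ (i,j) * adj_eigenvalues G ! j)"
    unfolding U(2) using Uc by (intro mat_diag_mult_right) simp
  finally have AU: "adj_mat G * U = mat n n (\<lambda>(i,j). U $$ (i,j) * adj_eigenvalues G ! j)" .
  have aV: "a k \<in> V" if "k < n" for k using bij that by (auto simp: bij_betw_def)
  have "adj_eigenbasis G (\<lambda>i v. U $$ (idx v, i))"
  proof (rule adj_eigenbasis.intro)
    fix i j assume "i < card (pverts G)" "j < card (pverts G)"
    hence ij: "i < n" "j < n" by (auto simp: n_def V_def)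
    have "inner_on V (\<lambda>v. U $$ (idx v, i)) (\<lambda>v. U $$ (idx v, j)) = (U\<^sup>T * U) $$ (i,j)"
      using ij Uc(1) by (simp add: inner_on_def reindex idx scalar_prod_def atLeast0LessThan)
    thus "inner_on (pverts G) (\<lambda>v. U $$ (idx v, i)) (\<lambda>v. U $$ (idx v, j)) = of_bool (i = j)"
      using ij by (simp add: Uc(3) V_def)
  next
    fix u v assume "u \<in> pverts G" "v \<in> pverts G"
    hence "u \<in> V" "v \<in> V" by (simp_all add: V_def)
    then obtain k l where kl: "k < n" "l < n" "u = a k" "v = a l" using V by meson
    have "(\<Sum>i<n. U $$ (k, i) * U $$ (l, i)) = (U * U\<^sup>T) $$ (k,l)"
      using kl Uc(1) by (simp add: scalar_prod_def atLeast0LessThan)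
    moreover have "a k = a l \<longleftrightarrow> k = l" using kl idx by metis
    ultimately show "(\<Sum>i<card (pverts G). U $$ (idx u, i) * U $$ (idx v, i)) = of_bool (u = v)"
      using kl by (simp add: Uc(4) idx n_def[symmetric] V_def[symmetric])
  next
    fix i u assume iu: "i < card (pverts G)" "u \<in> pverts G"
    then obtain k where k: "k < n" "u = a k" using V by (auto simp: V_def)
    have i: "i < n" using iu by (simp add: n_def V_def)
    have "(\<Sum>j<n. of_bool ((a k, a j) \<in> parcs G) * U $$ (j, i)) = (adj_mat G * U) $$ (k,i)"
      using k i Uc(1) unfolding adj_mat_def n_def[unfolded V_def, symmetric] a_def V_def
      by (simp add: scalar_prod_def atLeast0LessThan of_bool_def)
    also have "\<dots> = adj_eigenvalues G ! i * U $$ (k,i)"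
      unfolding AU using k i by simp
    finally show "adj_apply G (\<lambda>v. U $$ (idx v, i)) u = adj_eigenvalue (Suc i) G * U $$ (idx u, i)"
      using k by (simp add: adj_apply_def V_def[symmetric] reindex idx adj_eigenvalue_def)
  qed (rule G)
  thus ?thesis by (rule that)
qed

section \<open>Expansion in eigenfunctions\<close>

context adj_eigenbasis
begin

abbreviation "n \<equiv> card (pverts G)"
abbreviation "coef f i \<equiv> inner_on (pverts G) f (\<phi> i)"

lemma expansion:
  assumes "v \<in> pverts G"
  shows "f v = (\<Sum>i<n. coef f i * \<phi> i v)"
proof -
  have "(\<Sum>i<n. coef f i * \<phi> i v) = (\<Sum>i<n. \<Sum>u\<in>pverts G. f u * (\<phi> i u * \<phi> i v))"
    by (simp add: inner_on_def sum_distrib_left mult_ac)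
  also have "\<dots> = (\<Sum>u\<in>pverts G. \<Sum>i<n. f u * (\<phi> i u * \<phi> i v))"
    by (rule sum.swap)
  also have "\<dots> = (\<Sum>u\<in>pverts G. f u * of_bool (u = v))"
    using assms by (simp add: sum_distrib_left[symmetric] complete)
  also have "\<dots> = f v"
    using assms pair_graph_finite[OF graph] by (simp add: of_bool_def if_distrib cong: if_cong)
  finally show ?thesis by simp
qed

lemma inner_on_expansion:
  assumes "\<And>v. v \<in> pverts G \<Longrightarrow> g v = (\<Sum>i<n. b i * \<phi> i v)"
  shows "inner_on (pverts G) f g = (\<Sum>i<n. b i * coef f i)"
proof -
  have "inner_on (pverts G) f g = (\<Sum>v\<in>pverts G. \<Sum>i<n. f v * (b i * \<phi> i v))"
    by (simp add: inner_on_def assms sum_distrib_left)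
  also have "\<dots> = (\<Sum>i<n. \<Sum>v\<in>pverts G. f v * (b i * \<phi> i v))"
    by (rule sum.swap)
  finally show ?thesis by (simp add: inner_on_def sum_distrib_left mult_ac)
qed

lemma adj_apply_expansion:
  assumes "u \<in> pverts G"
  shows "adj_apply G f u = (\<Sum>i<n. adj_eigenvalue (Suc i) G * coef f i * \<phi> i u)"
proof -
  have "adj_apply G f u = adj_apply G (\<lambda>v. \<Sum>i<n. coef f i * \<phi> i v) u"
    by (intro adj_apply_cong expansion)
  also have "\<dots> = (\<Sum>i<n. coef f i * adj_apply G (\<phi> i) u)"
    by (simp add: adj_apply_sum adj_apply_scale)
  also have "\<dots> = (\<Sum>i<n. adj_eigenvalue (Suc i) G * coef f i * \<phi> i u)"
    using assms by (intro sum.cong refl) (simp add: eigen)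
  finally show ?thesis .
qed

lemma inner_on_self: "inner_on (pverts G) f f = (\<Sum>i<n. (coef f i)\<^sup>2)"
  using inner_on_expansion[OF expansion, of f f] by (simp add: power2_eq_square)

lemma adj_form_expansion: "adj_form G f = (\<Sum>i<n. adj_eigenvalue (Suc i) G * (coef f i)\<^sup>2)"
  unfolding adj_form_def
  using inner_on_expansion[OF adj_apply_expansion, of f f] by (simp add: power2_eq_square mult.assoc)

text \<open>One half of the Courant-Fischer principle: a function orthogonal to the first
  \<open>k\<close> eigenfunctions involves only eigenvalues that are at most the one with index
  \<open>Suc k\<close>. It is used with \<open>k = 0\<close> and \<open>k = 1\<close>.\<close>

lemma adj_form_le:
  assumes "k < n" and "\<And>i. i < k \<Longrightarrow> coef f i = 0"
  shows "adj_form G f \<le> adj_eigenvalue (Suc k) G * inner_on (pverts G) f f"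
  unfolding adj_form_expansion inner_on_self sum_distrib_left
proof (intro sum_mono)
  fix i assume "i \<in> {..<n}"
  thus "adj_eigenvalue (Suc i) G * (coef f i)\<^sup>2 \<le> adj_eigenvalue (Suc k) G * (coef f i)\<^sup>2"
    using adj_eigenvalue_antimono[OF graph, of k i] assms(2)[of i]
    by (cases "i < k") (auto intro: mult_right_mono)
qed

text \<open>The gap to the upper bound is a sum of nonnegative terms, one for each eigenfunction. If
  it is zero, every eigenfunction with nonzero coefficient belongs to the largest
  eigenvalue.\<close>

lemma adj_form_eq_imp_eigenfunction:
  assumes eq: "adj_form G f = adj_eigenvalue 1 G * inner_on (pverts G) f f" and u: "u \<in> pverts G"
  shows "adj_apply G f u = adj_eigenvalue 1 G * f u"
proof -
  have n: "0 < n" using u pair_graph_finite[OF graph] by (auto simp: card_gt_0_iff)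
  have "(\<Sum>i<n. (adj_eigenvalue 1 G - adj_eigenvalue (Suc i) G) * (coef f i)\<^sup>2) = 0"
    using eq unfolding adj_form_expansion inner_on_self
    by (simp add: left_diff_distrib sum_subtractf sum_distrib_left)
  moreover have "(adj_eigenvalue 1 G - adj_eigenvalue (Suc i) G) * (coef f i)\<^sup>2 \<ge> 0" if "i < n" for i
    using adj_eigenvalue_antimono[OF graph, of 0 i] that by simp
  ultimately have zero: "\<forall>i\<in>{..<n}. (adj_eigenvalue 1 G - adj_eigenvalue (Suc i) G) * (coef f i)\<^sup>2 = 0"
    by (subst (asm) sum_nonneg_eq_0_iff) auto
  hence *: "adj_eigenvalue (Suc i) G * coef f i = adj_eigenvalue 1 G * coef f i" if "i < n" for i
    using bspec[OF zero, of i] that by (cases "coef f i = 0") auto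
  have "adj_apply G f u = (\<Sum>i<n. adj_eigenvalue 1 G * coef f i * \<phi> i u)"
    unfolding adj_apply_expansion[OF u] using * by (intro sum.cong refl) simp
  also have "\<dots> = adj_eigenvalue 1 G * f u"
    using expansion[OF u, of f] by (simp add: sum_distrib_left mult.assoc)
  finally show ?thesis .
qed

end

lemma adj_form_le_spectral_radius:
  assumes "pair_graph G"
  shows "adj_form G f \<le> graph_spectral_radius G * inner_on (pverts G) f f"
proof (cases "pverts G = {}")
  \<comment> \<open>Without vertices the spectral radius is a meaningless default value, but both
    sides are zero.\<close>
  case True
  thus ?thesis by (simp add: adj_form_def inner_on_def)
next
  case False
  obtain \<phi> where "adj_eigenbasis G \<phi>" using adj_eigenbasis_exists[OF assms] .
  then interpret adj_eigenbasis G \<phi> .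
  show ?thesis
    using adj_form_le[of 0 f] False pair_graph_finite[OF assms]
    by (simp add: graph_spectral_radius_def card_gt_0_iff)
qed

lemma spectral_radius_attained:
  assumes "pair_graph G" "pverts G \<noteq> {}"
  obtains f where "inner_on (pverts G) f f = 1" "adj_form G f = graph_spectral_radius G"
proof -
  obtain \<phi> where "adj_eigenbasis G \<phi>" using adj_eigenbasis_exists[OF assms(1)] .
  then interpret adj_eigenbasis G \<phi> .
  have n: "0 < n" using assms pair_graph_finite by (auto simp: card_gt_0_iff)
  have "adj_form G (\<phi> 0) = inner_on (pverts G) (\<phi> 0) (\<lambda>u. adj_eigenvalue 1 G * \<phi> 0 u)"
    unfolding adj_form_def using eigen[OF n] by (intro inner_on_cong) auto
  thus ?thesis
    using orth[OF n n] that[of "\<phi> 0"] by (simp add: graph_spectral_radius_def inner_on_linear)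
qed

lemma spectral_radius_ge:
  assumes "pair_graph G" "adj_form G f \<ge> c * inner_on (pverts G) f f" "inner_on (pverts G) f f > 0"
  shows "c \<le> graph_spectral_radius G"
  using adj_form_le_spectral_radius[OF assms(1), of f] assms(2,3)
  by (meson mult_le_cancel_right_pos order_trans)

section \<open>Extremal spectral radius and connected graphs\<close>

definition induced_pgraph :: "'a pair_pre_digraph \<Rightarrow> 'a set \<Rightarrow> 'a pair_pre_digraph" where
  "induced_pgraph G S = \<lparr>pverts = S, parcs = parcs G \<inter> S \<times> S\<rparr>"

lemma induced_pgraph_simps [simp]:
  "pverts (induced_pgraph G S) = S" "parcs (induced_pgraph G S) = parcs G \<inter> S \<times> S"
  by (simp_all add: induced_pgraph_def)

lemma pair_graph_induced:
  assumes "pair_graph G" "S \<subseteq> pverts G"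
  shows "pair_graph (induced_pgraph G S)"
  using assms pair_graph_finite[OF assms(1)]
  by (intro pair_graphI)
     (auto simp: sym_def irrefl_def pair_graph_no_loop intro: finite_subset dest: pair_graph_sym[THEN iffD1, rotated])

lemma free_of_subgraph:
  assumes "free_of F G" "pverts H \<subseteq> pverts G" "parcs H \<subseteq> parcs G"
  shows "free_of F H"
  using assms unfolding free_of_def contains_copy_def by (meson subset_iff order_trans)

text \<open>Terms with a vertex outside \<open>S\<close> vanish. \<open>H\<close> is described by
  its vertices and arcs, so that both \<open>induced_pgraph\<close> and the two sides of a join
  qualify.\<close>

lemma adj_form_subgraph:
  assumes G: "pair_graph G" and S: "S \<subseteq> pverts G"
    and H: "pverts H = S" "parcs H = parcs G \<inter> S \<times> S"
    and f: "\<And>v. v \<in> pverts G \<Longrightarrow> v \<notin> S \<Longrightarrow> f v = 0"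
  shows "adj_form H f = adj_form G f" "inner_on S f f = inner_on (pverts G) f f"
proof -
  note fin = pair_graph_finite[OF G]
  have "adj_form H f = (\<Sum>u\<in>S. \<Sum>v\<in>S. of_bool ((u, v) \<in> parcs G) * f u * f v)"
    unfolding adj_form_altdef H by (intro sum.cong refl) auto
  also have "\<dots> = (\<Sum>u\<in>S. \<Sum>v\<in>pverts G. of_bool ((u, v) \<in> parcs G) * f u * f v)"
    using fin S f by (intro sum.cong refl sum.mono_neutral_left) auto
  also have "\<dots> = adj_form G f"
    unfolding adj_form_altdef using fin S f by (intro sum.mono_neutral_left) auto
  finally show "adj_form H f = adj_form G f" .
  show "inner_on S f f = inner_on (pverts G) f f"
    unfolding inner_on_def using fin S f by (intro sum.mono_neutral_left) auto
qed

text \<open>The radius depends only on a 0/1 matrix of order \<open>m\<close>. Finiteness makes the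
  \<open>Max\<close> in \<open>max_spectral_radius\<close> a genuine upper bound.\<close>

lemma finite_spectral_radii:
  "finite {graph_spectral_radius H | H :: 'a pair_pre_digraph. card (pverts H) = m}"
proof (rule finite_subset)
  \<comment> \<open>Functions restricted to the index square form a finite set, and
    \<open>mat m m\<close> reads no other values.\<close>
  let ?K = "({..<m} \<times> {..<m}) \<rightarrow>\<^sub>E {0, 1 :: real}"
  let ?r = "\<lambda>f. rev (sorted_list_of_multiset (proots (char_poly (mat m m f)))) ! 0"
  show "finite (?r ` ?K)" by (intro finite_imageI finite_PiE) auto
  show "{graph_spectral_radius H | H :: 'a pair_pre_digraph. card (pverts H) = m} \<subseteq> ?r ` ?K"
  proof
    fix r assume "r \<in> {graph_spectral_radius H | H :: 'a pair_pre_digraph. card (pverts H) = m}"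
    then obtain H :: "'a pair_pre_digraph" where m: "card (pverts H) = m"
      and r: "r = graph_spectral_radius H" by blast
    define f where "f = restrict (\<lambda>(i, j). if (from_nat_into (pverts H) i, from_nat_into (pverts H) j)
      \<in> parcs H then 1 else 0 :: real) ({..<m} \<times> {..<m})"
    have "f \<in> ?K" unfolding f_def by (auto split: if_splits)
    moreover have "adj_mat H = mat m m f"
      unfolding adj_mat_def m by (rule eq_matI) (auto simp: f_def)
    hence "graph_spectral_radius H = ?r f"
      by (simp add: graph_spectral_radius_def adj_eigenvalue_def adj_eigenvalues_def)
    ultimately show "r \<in> ?r ` ?K" unfolding r by blast
  qed
qed

text \<open>\<open>max_spectral_radius\<close> ranges over graphs on natural numbers, so
  \<open>H\<close> is copied along an enumeration of its vertices. A lower bound for the radius of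
  the copy suffices, and a transported maximiser of the Rayleigh quotient gives it without comparing
  the two matrices.\<close>

lemma spectral_radius_le_max:
  fixes H :: "'a pair_pre_digraph"
  assumes H: "pair_graph H" and m: "card (pverts H) = m" "0 < m" and F: "free_of F H"
  shows "graph_spectral_radius H \<le> max_spectral_radius m F"
proof -
  define h where "h = from_nat_into (pverts H)"
  have bij: "bij_betw h {..<m} (pverts H)"
    unfolding h_def m(1)[symmetric] by (rule bij_betw_from_nat_into_finite[OF pair_graph_finite[OF H]])
  hence inj: "inj_on h {..<m}" and im: "h ` {..<m} = pverts H" by (auto simp: bij_betw_def)
  define H' :: "nat pair_pre_digraph" where
    "H' = \<lparr>pverts = {..<m}, parcs = {(i, j). i < m \<and> j < m \<and> (h i, h j) \<in> parcs H}\<rparr>"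
  have V': "pverts H' = {..<m}" and
    E': "(i, j) \<in> parcs H' \<longleftrightarrow> i < m \<and> j < m \<and> (h i, h j) \<in> parcs H" for i j
    by (auto simp: H'_def)
  have H': "pair_graph H'"
    by (rule pair_graphI)
       (auto simp: V' E' sym_def irrefl_def pair_graph_no_loop[OF H] pair_graph_sym[OF H])
  have "free_of F H'"
    unfolding free_of_def contains_copy_def
  proof safe
    fix f assume f: "inj_on f (pverts F)" "f ` pverts F \<subseteq> pverts H'"
      "\<forall>u v. (u, v) \<in> parcs F \<longrightarrow> (f u, f v) \<in> parcs H'"
    have "inj_on (h \<circ> f) (pverts F)"
      using f(1,2) inj by (intro comp_inj_on) (auto simp: V' intro: inj_on_subset)
    moreover have "(h \<circ> f) ` pverts F \<subseteq> pverts H" using f(2) im by (auto simp: V')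
    moreover have "\<forall>u v. (u, v) \<in> parcs F \<longrightarrow> ((h \<circ> f) u, (h \<circ> f) v) \<in> parcs H"
      using f(3) by (auto simp: E')
    ultimately show False using F unfolding free_of_def contains_copy_def by blast
  qed
  hence le: "graph_spectral_radius H' \<le> max_spectral_radius m F"
    unfolding max_spectral_radius_def using H'
    by (intro Max_ge finite_subset[OF _ finite_spectral_radii[of m]]) (auto simp: V')
  have "pverts H \<noteq> {}" using m by auto
  then obtain f where f: "inner_on (pverts H) f f = 1" "adj_form H f = graph_spectral_radius H"
    using spectral_radius_attained[OF H] by blast
  have reindex: "(\<Sum>v\<in>pverts H. g v) = (\<Sum>k<m. g (h k))" for g :: "'a \<Rightarrow> real"
    using sum.reindex_bij_betw[OF bij] by metis
  have "adj_form H' (f \<circ> h) = adj_form H f"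
    unfolding adj_form_altdef reindex V' by (intro sum.cong refl) (auto simp: E')
  moreover have "inner_on (pverts H') (f \<circ> h) (f \<circ> h) = inner_on (pverts H) f f"
    unfolding inner_on_def reindex V' by simp
  ultimately have "graph_spectral_radius H \<le> graph_spectral_radius H'"
    using f by (intro spectral_radius_ge[OF H', of _ "f \<circ> h"]) auto
  thus ?thesis using le by simp
qed

text \<open>Enlarging the support to exactly \<open>m\<close> vertices of \<open>G\<close> gives an
  induced subgraph that inherits \<open>F\<close>-freeness. This turns \<open>F\<close>-freeness
  into a bound for every test function with small support.\<close>

lemma adj_form_le_max_spectral_radius:
  assumes G: "pair_graph G" and F: "free_of F G"
    and m: "0 < m" "m \<le> card (pverts G)" and supp: "card {v \<in> pverts G. f v \<noteq> 0} \<le> m"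
  shows "adj_form G f \<le> max_spectral_radius m F * inner_on (pverts G) f f"
proof -
  obtain S where S: "{v \<in> pverts G. f v \<noteq> 0} \<subseteq> S" "S \<subseteq> pverts G" "card S = m"
    using exists_subset_between[OF supp m(2) _ pair_graph_finite[OF G]] by auto
  let ?H = "induced_pgraph G S"
  have H: "pair_graph ?H" using pair_graph_induced[OF G S(2)] .
  have "free_of F ?H" by (rule free_of_subgraph[OF F]) (use S(2) in auto)
  hence "graph_spectral_radius ?H \<le> max_spectral_radius m F"
    using spectral_radius_le_max[OF H] S m by auto
  hence "graph_spectral_radius ?H * inner_on S f f \<le> max_spectral_radius m F * inner_on S f f"
    by (intro mult_right_mono inner_on_self_nonneg)
  moreover have "f v = 0" if "v \<in> pverts G" "v \<notin> S" for v using that S(1) by auto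
  note adj_form_subgraph[OF G S(2), of ?H f, OF _ _ this]
  ultimately show ?thesis using adj_form_le_spectral_radius[OF H, of f] by simp
qed

section \<open>Connected graphs: the Perron vector and a sign-changing second eigenfunction\<close>

lemma connected_arc_leaving:
  assumes G: "pair_graph G" and conn: "Digraph_Component.connected (with_proj G)"
    and S: "S \<subseteq> pverts G" "S \<noteq> {}" "S \<noteq> pverts G"
  obtains u v where "u \<in> S" "v \<in> pverts G - S" "(u, v) \<in> parcs G"
proof -
  obtain a b where ab: "a \<in> S" "b \<in> pverts G" "b \<notin> S" using S by auto
  have "(a, b) \<in> rtrancl_on (pverts G) ((parcs G)\<^sup>s)"
    using conn ab S(1) by (auto simp: connected_conv)
  moreover have "(parcs G)\<^sup>s = parcs G"
    using pair_graph_sym[OF G] by (auto simp: symcl_def)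
  ultimately have path: "(a, b) \<in> rtrancl_on (pverts G) (parcs G)" by simp
  \<comment> \<open>A set closed under outgoing arcs contains every vertex reachable from it, so
    without a leaving arc \<open>b\<close> would lie in \<open>S\<close>.\<close>
  have "b \<in> S" if "\<And>u v. u \<in> S \<Longrightarrow> (u, v) \<in> parcs G \<Longrightarrow> v \<in> S"
    using path ab(1) by (induction rule: rtrancl_on_induct) (auto intro: that)
  thus ?thesis using ab(3) that pair_graph_arcD[OF G] by blast
qed

text \<open>Taking absolute values of a maximiser of the Rayleigh quotient does not decrease the
  form, so \<open>w\<close> is again a maximiser and hence an eigenfunction. At a zero of
  \<open>w\<close> all neighbours are zeros too, which connectedness excludes unless
  \<open>w\<close> vanishes everywhere.\<close>

lemma perron_vector:
  assumes G: "pair_graph G" and conn: "Digraph_Component.connected (with_proj G)"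
    and V: "pverts G \<noteq> {}"
  obtains w where "\<And>v. v \<in> pverts G \<Longrightarrow> w v > 0"
    "\<And>u. u \<in> pverts G \<Longrightarrow> adj_apply G w u = graph_spectral_radius G * w u"
proof -
  obtain f where f: "inner_on (pverts G) f f = 1" "adj_form G f = graph_spectral_radius G"
    using spectral_radius_attained[OF G V] .
  define w where "w v = \<bar>f v\<bar>" for v
  have w1: "inner_on (pverts G) w w = 1" using f(1) by (simp add: inner_on_def w_def)
  have "adj_form G f \<le> adj_form G w"
    unfolding adj_form_altdef w_def
    by (intro sum_mono) (auto simp: of_bool_def abs_mult[symmetric])
  hence eq: "adj_form G w = adj_eigenvalue 1 G * inner_on (pverts G) w w"
    using adj_form_le_spectral_radius[OF G, of w] f(2) w1 by (simp add: graph_spectral_radius_def)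
  obtain \<phi> where "adj_eigenbasis G \<phi>" using adj_eigenbasis_exists[OF G] .
  then interpret adj_eigenbasis G \<phi> .
  have ev: "adj_apply G w u = graph_spectral_radius G * w u" if "u \<in> pverts G" for u
    using adj_form_eq_imp_eigenfunction[OF eq that] by (simp add: graph_spectral_radius_def)
  define Z where "Z = {v \<in> pverts G. w v = 0}"
  have "Z = {}"
  proof (rule ccontr)
    assume "Z \<noteq> {}"
    moreover have "Z \<noteq> pverts G"
    proof
      assume "Z = pverts G"
      hence "\<forall>v\<in>pverts G. w v = 0" by (auto simp: Z_def)
      hence "inner_on (pverts G) w w = 0" by (simp add: inner_on_def)
      with w1 show False by simp
    qed
    ultimately obtain u v where uv: "u \<in> Z" "v \<in> pverts G - Z" "(u, v) \<in> parcs G"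
      using connected_arc_leaving[OF G conn, of Z] by (auto simp: Z_def)
    have "adj_apply G w u = 0" using uv ev by (auto simp: Z_def)
    hence "of_bool ((u, v) \<in> parcs G) * w v = 0"
      unfolding adj_apply_def using uv pair_graph_finite[OF G]
      by (subst (asm) sum_nonneg_eq_0_iff) (auto simp: w_def)
    with uv show False by (auto simp: Z_def)
  qed
  hence "w v > 0" if "v \<in> pverts G" for v using that by (force simp: Z_def w_def)
  with ev show ?thesis using that by blast
qed

text \<open>A nonzero function orthogonal to the positive Perron vector \<open>w\<close> must change
  sign. Simplicity of the largest eigenvalue is not presupposed, so the case that
  \<open>\<phi> 1\<close> is not orthogonal to \<open>w\<close> is treated separately.\<close>

lemma second_eigenfunction:
  assumes G: "pair_graph G" and conn: "Digraph_Component.connected (with_proj G)"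
    and n: "2 \<le> card (pverts G)"
  obtains x where "\<And>u. u \<in> pverts G \<Longrightarrow> adj_apply G x u = adj_eigenvalue 2 G * x u"
    "\<exists>v\<in>pverts G. x v > 0" "\<exists>v\<in>pverts G. x v < 0"
proof -
  have V: "pverts G \<noteq> {}" using n by auto
  obtain w where w: "\<And>v. v \<in> pverts G \<Longrightarrow> w v > 0"
    "\<And>u. u \<in> pverts G \<Longrightarrow> adj_apply G w u = graph_spectral_radius G * w u"
    using perron_vector[OF G conn V] by blast
  obtain \<phi> where "adj_eigenbasis G \<phi>" using adj_eigenbasis_exists[OF G] .
  then interpret adj_eigenbasis G \<phi> .
  define b where "b i = inner_on (pverts G) w (\<phi> i)" for i
  have n01: "0 < n" "1 < n" using n by auto
  have e0: "adj_apply G (\<phi> 0) u = graph_spectral_radius G * \<phi> 0 u" if "u \<in> pverts G" for u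
    using eigen[OF n01(1) that] by (simp add: graph_spectral_radius_def)
  have e1: "adj_apply G (\<phi> 1) u = adj_eigenvalue 2 G * \<phi> 1 u" if "u \<in> pverts G" for u
    using eigen[OF n01(2) that] by (simp add: numeral_2_eq_2)
  have "\<exists>x. (\<forall>u\<in>pverts G. adj_apply G x u = adj_eigenvalue 2 G * x u) \<and>
      inner_on (pverts G) w x = 0 \<and> inner_on (pverts G) x x \<noteq> 0"
  proof (cases "b 1 = 0")
    case True
    thus ?thesis using e1 orth[OF n01(2) n01(2)] by (intro exI[of _ "\<phi> 1"]) (auto simp: b_def)
  next
    case False
    \<comment> \<open>Self-adjointness gives both eigenvalues the same product with
      \<open>b 1\<close>, so they coincide. Every combination of \<open>\<phi> 0\<close> and
      \<open>\<phi> 1\<close> is then an eigenfunction, and \<open>x\<close> is one orthogonal to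
      \<open>w\<close>.\<close>
    have "graph_spectral_radius G * b 1 = inner_on (pverts G) (adj_apply G w) (\<phi> 1)"
      unfolding b_def inner_on_scale_left[symmetric] using w(2) by (intro inner_on_cong) auto
    also have "\<dots> = inner_on (pverts G) w (adj_apply G (\<phi> 1))"
      by (simp add: adj_apply_self_adjoint[OF G])
    also have "\<dots> = adj_eigenvalue 2 G * b 1"
      unfolding b_def inner_on_scale_right[symmetric] using e1 by (intro inner_on_cong) auto
    finally have eq: "graph_spectral_radius G = adj_eigenvalue 2 G" using False by simp
    define x where "x v = b 1 * \<phi> 0 v + (- b 0) * \<phi> 1 v" for v
    have "adj_apply G x u = adj_eigenvalue 2 G * x u" if "u \<in> pverts G" for u
      unfolding x_def adj_apply_add adj_apply_scale
      using e0[OF that] e1[OF that] by (simp add: eq algebra_simps)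
    moreover have "inner_on (pverts G) w x = 0"
      unfolding x_def inner_on_linear by (simp add: b_def)
    moreover have "inner_on (pverts G) x x = (b 1)\<^sup>2 + (b 0)\<^sup>2"
      unfolding x_def inner_on_linear using orth n01 by (simp add: power2_eq_square)
    ultimately show ?thesis using False by (intro exI[of _ x]) (auto simp: add_nonneg_eq_0_iff)
  qed
  then obtain x where x: "\<forall>u\<in>pverts G. adj_apply G x u = adj_eigenvalue 2 G * x u"
    "inner_on (pverts G) w x = 0" "inner_on (pverts G) x x \<noteq> 0" by blast
  obtain v where v: "v \<in> pverts G" "x v \<noteq> 0" using x(3) by (rule inner_on_self_neq_zeroE)
  \<comment> \<open>With \<open>s\<close> equal to -1 and 1, one argument excludes both that
    \<open>x\<close> is nowhere positive and that it is nowhere negative.\<close>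
  have no_sign: False if "\<And>v. v \<in> pverts G \<Longrightarrow> 0 \<le> s * x v" "s \<noteq> 0" for s :: real
  proof -
    have "(\<Sum>v\<in>pverts G. w v * (s * x v)) = s * inner_on (pverts G) w x"
      by (simp add: inner_on_def sum_distrib_left mult_ac)
    hence "(\<Sum>v\<in>pverts G. w v * (s * x v)) = 0" using x(2) by simp
    moreover have "0 \<le> w v * (s * x v)" if "v \<in> pverts G" for v
      using w(1)[OF that] \<open>\<And>v. v \<in> pverts G \<Longrightarrow> 0 \<le> s * x v\<close>[OF that] by simp
    ultimately have "w v * (s * x v) = 0"
      using v(1) pair_graph_finite[OF G] by (simp add: sum_nonneg_eq_0_iff)
    with w(1)[OF v(1)] v(2) that(2) show False by simp
  qed
  have "\<exists>v\<in>pverts G. x v > 0" using no_sign[of "-1"] by (force simp: not_less)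
  moreover have "\<exists>v\<in>pverts G. x v < 0" using no_sign[of 1] by (force simp: not_less)
  ultimately show ?thesis using that x(1) by blast
qed

section \<open>The second eigenvalue\<close>

text \<open>Since \<open>x\<close> is \<open>p\<close> minus \<open>q\<close>, the operator maps
  \<open>p\<close> to \<open>c\<close> times \<open>x\<close> plus the image of \<open>q\<close>,
  and \<open>p\<close> times \<open>x\<close> is the square of \<open>p\<close>. The cross term
  collects the arcs between positive and negative vertices.\<close>

lemma positive_part_form:
  assumes G: "pair_graph G"
    and x: "\<And>u. u \<in> pverts G \<Longrightarrow> adj_apply G x u = c * x u"
  defines "p \<equiv> \<lambda>v. max (x v) 0" and "q \<equiv> \<lambda>v. max (- x v) 0"
  shows "adj_form G p = c * inner_on (pverts G) p p + inner_on (pverts G) p (adj_apply G q)"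
proof -
  have "x v = p v + (-1) * q v" for v by (simp add: p_def q_def)
  hence x': "x = (\<lambda>v. p v + (-1) * q v)" by blast
  have *: "adj_apply G p u = c * x u + adj_apply G q u" if "u \<in> pverts G" for u
    using x[OF that] adj_apply_add[of G p "\<lambda>v. (-1) * q v" u] adj_apply_scale[of G "-1" q u] x'
    by simp
  have "adj_form G p = inner_on (pverts G) p (\<lambda>u. c * x u + adj_apply G q u)"
    unfolding adj_form_def using * by (intro inner_on_cong) auto
  also have "\<dots> = c * inner_on (pverts G) p x + inner_on (pverts G) p (adj_apply G q)"
    by (simp add: inner_on_linear)
  also have "inner_on (pverts G) p x = inner_on (pverts G) p p"
    unfolding inner_on_def p_def by (intro sum.cong refl) auto
  finally show ?thesis .
qed

text \<open>The cross term is nonnegative, so the Rayleigh quotient of \<open>p\<close> is at least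
  \<open>c\<close>, while its small support bounds it by the extremal radius. In the equality case
  the cross term is zero; being a sum of nonnegative terms, it leaves no arc from a positive to a
  negative vertex.\<close>

lemma eigenvalue_le_via_small_positive_part:
  assumes G: "pair_graph G" and F: "free_of F G"
    and m: "0 < m" "m \<le> card (pverts G)"
    and x: "\<And>u. u \<in> pverts G \<Longrightarrow> adj_apply G x u = c * x u"
    and pos: "\<exists>v\<in>pverts G. x v > 0"
    and small: "card {v \<in> pverts G. x v > 0} \<le> m"
  shows "c \<le> max_spectral_radius m F"
    and "c = max_spectral_radius m F \<Longrightarrow> adj_form G (\<lambda>v. max (x v) 0) =
      c * inner_on (pverts G) (\<lambda>v. max (x v) 0) (\<lambda>v. max (x v) 0)"
    and "c = max_spectral_radius m F \<Longrightarrow> (u, v) \<in> parcs G \<Longrightarrow> x u > 0 \<Longrightarrow> x v \<ge> 0"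
proof -
  define p where "p v = max (x v) 0" for v
  define q where "q v = max (- x v) 0" for v
  note fin = pair_graph_finite[OF G]
  have form: "adj_form G p = c * inner_on (pverts G) p p + inner_on (pverts G) p (adj_apply G q)"
    using positive_part_form[OF G x] by (simp add: p_def[abs_def] q_def[abs_def])
  have nonneg: "0 \<le> p v * adj_apply G q v" for v
    by (intro mult_nonneg_nonneg adj_apply_nonneg) (auto simp: p_def q_def)
  hence cross: "inner_on (pverts G) p (adj_apply G q) \<ge> 0"
    unfolding inner_on_def by (intro sum_nonneg) auto
  have pp: "inner_on (pverts G) p p > 0"
  proof -
    obtain v where "v \<in> pverts G" "x v > 0" using pos by blast
    thus ?thesis by (intro inner_on_self_pos[OF fin, of v]) (auto simp: p_def)
  qed
  have "{v \<in> pverts G. p v \<noteq> 0} = {v \<in> pverts G. x v > 0}" by (auto simp: p_def max_def)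
  hence le: "adj_form G p \<le> max_spectral_radius m F * inner_on (pverts G) p p"
    using adj_form_le_max_spectral_radius[OF G F m, of p] small by simp
  with form cross have "c * inner_on (pverts G) p p \<le> max_spectral_radius m F * inner_on (pverts G) p p"
    by simp
  thus "c \<le> max_spectral_radius m F" using pp by simp
  assume c: "c = max_spectral_radius m F"
  hence zero: "inner_on (pverts G) p (adj_apply G q) = 0" using form le cross by simp
  thus "adj_form G (\<lambda>v. max (x v) 0) = c * inner_on (pverts G) (\<lambda>v. max (x v) 0) (\<lambda>v. max (x v) 0)"
    using form by (simp add: p_def[abs_def])
  assume uv: "(u, v) \<in> parcs G" "x u > 0"
  hence V: "u \<in> pverts G" "v \<in> pverts G" using pair_graph_arcD[OF G] by auto
  have "p u * adj_apply G q u = 0"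
    using zero nonneg V(1) fin unfolding inner_on_def by (simp add: sum_nonneg_eq_0_iff)
  hence "adj_apply G q u = 0" using uv(2) by (auto simp: p_def)
  hence "of_bool ((u, v) \<in> parcs G) * q v = 0"
    unfolding adj_apply_def using V(2) fin
    by (subst (asm) sum_nonneg_eq_0_iff) (auto simp: q_def)
  thus "x v \<ge> 0" using uv(1) by (auto simp: q_def max_def split: if_splits)
qed

text \<open>
  If the positive part had fewer than \<open>m\<close> vertices, adding a small multiple of the indicator of a
  neighbouring vertex would push the Rayleigh quotient above the extremal value.
\<close>

lemma positive_part_card:
  assumes G: "pair_graph G" and F: "free_of F G"
    and conn: "Digraph_Component.connected (with_proj G)"
    and m: "0 < m" "m \<le> card (pverts G)"
    and x: "\<And>u. u \<in> pverts G \<Longrightarrow> adj_apply G x u = c * x u"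
    and pos: "\<exists>v\<in>pverts G. x v > 0" and neg: "\<exists>v\<in>pverts G. x v < 0"
    and small: "card {v \<in> pverts G. x v > 0} \<le> m"
    and c: "c = max_spectral_radius m F"
  shows "card {v \<in> pverts G. x v > 0} = m" and "\<exists>v\<in>pverts G. x v = 0"
proof -
  define P where "P = {v \<in> pverts G. x v > 0}"
  define p where "p v = max (x v) 0" for v
  note fin = pair_graph_finite[OF G]
  have form: "adj_form G p = c * inner_on (pverts G) p p"
    using eigenvalue_le_via_small_positive_part(2)[OF G F m x pos small c] by (simp add: p_def[abs_def])
  have "P \<subseteq> pverts G" "P \<noteq> {}" using pos by (auto simp: P_def)
  moreover have "P \<noteq> pverts G" using neg unfolding P_def by force
  ultimately obtain u z where uz: "u \<in> P" "z \<in> pverts G - P" "(u, z) \<in> parcs G"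
    using connected_arc_leaving[OF G conn] by blast
  \<comment> \<open>The end \<open>z\<close> of the leaving arc is not in \<open>P\<close>, hence
    not positive, and by the equality case it is not negative.\<close>
  hence xz: "x z = 0" using eigenvalue_le_via_small_positive_part(3)[OF G F m x pos small c uz(3)]
    by (force simp: P_def)
  thus "\<exists>v\<in>pverts G. x v = 0" using uz by auto
  show "card {v \<in> pverts G. x v > 0} = m"
  proof (rule ccontr)
    assume "card {v \<in> pverts G. x v > 0} \<noteq> m"
    hence card: "card P < m" using small by (simp add: P_def)
    define d where "d v = (of_bool (v = z) :: real)" for v
    have inner_on_d: "inner_on (pverts G) d g = g z" for g
    proof -
      have "inner_on (pverts G) d g = (\<Sum>v\<in>pverts G. if v = z then g v else 0)"
        unfolding inner_on_def d_def by (intro sum.cong) auto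
      thus ?thesis using fin uz(2) by simp
    qed
    \<comment> \<open>Without loops the indicator \<open>d\<close> of \<open>z\<close> has form
      value zero, so adding a multiple of it changes the form only through the cross term.\<close>
    have dd: "adj_apply G d z = 0"
      unfolding adj_apply_def d_def by (intro sum.neutral) (auto simp: pair_graph_no_loop[OF G])
    define b where "b = adj_apply G p z"
    have "b > 0"
      unfolding b_def adj_apply_def
    proof (rule sum_pos2[OF fin, of u])
      show "0 < of_bool ((z, u) \<in> parcs G) * p u"
        using uz pair_graph_sym[OF G, of u z] by (auto simp: P_def p_def)
    qed (use uz in \<open>auto simp: P_def p_def\<close>)
    \<comment> \<open>Adding \<open>\<epsilon> * d\<close> raises the form by
      \<open>2 * \<epsilon> * b\<close> and its upper bound by
      \<open>c * \<epsilon>\<^sup>2\<close>. With \<open>\<epsilon> = b / M\<close>, where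
      \<open>M\<close> is positive and above \<open>c\<close>, the first increase is the
      larger.\<close>
    define M where "M = \<bar>c\<bar> + 1"
    define \<epsilon> where "\<epsilon> = b / M"
    have "M > 0" by (simp add: M_def)
    hence "\<epsilon> > 0" using \<open>b > 0\<close> by (simp add: \<epsilon>_def)
    define f where "f v = p v + \<epsilon> * d v" for v
    have "{v \<in> pverts G. f v \<noteq> 0} \<subseteq> insert z P"
      by (auto simp: f_def d_def p_def P_def max_def split: if_splits)
    hence "card {v \<in> pverts G. f v \<noteq> 0} \<le> card (insert z P)"
      using fin by (intro card_mono) (auto simp: P_def)
    also have "\<dots> \<le> m" using card fin by (simp add: card_insert_if P_def)
    finally have le: "adj_form G f \<le> c * inner_on (pverts G) f f"
      using adj_form_le_max_spectral_radius[OF G F m, of f] c by simp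
    \<comment> \<open>As \<open>p\<close> vanishes at \<open>z\<close>, the squared norm of
      \<open>f\<close> has no mixed term.\<close>
    have pz: "p z = 0" using xz by (simp add: p_def)
    have pAd: "inner_on (pverts G) p (adj_apply G d) = b"
      using adj_apply_self_adjoint[OF G, of p d] inner_on_d[of "adj_apply G p"]
      by (simp add: b_def inner_on_commute)
    have "adj_form G f = adj_form G p + 2 * \<epsilon> * b"
      unfolding adj_form_def f_def adj_apply_add adj_apply_scale inner_on_linear
      by (simp add: pAd inner_on_d dd b_def[symmetric])
    moreover have "inner_on (pverts G) f f = inner_on (pverts G) p p + \<epsilon>\<^sup>2"
      unfolding f_def inner_on_linear inner_on_commute[of _ p d] inner_on_d
      using pz by (simp add: d_def power2_eq_square)
    ultimately have "2 * \<epsilon> * b \<le> c * \<epsilon>\<^sup>2" using le form by (simp add: algebra_simps)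
    hence "2 * b \<le> c * \<epsilon>" using \<open>\<epsilon> > 0\<close> by (simp add: power2_eq_square)
    also have "\<dots> \<le> M * \<epsilon>" using \<open>\<epsilon> > 0\<close> by (intro mult_right_mono) (auto simp: M_def)
    also have "\<dots> = b" using \<open>M > 0\<close> by (simp add: \<epsilon>_def)
    finally show False using \<open>b > 0\<close> by simp
  qed
qed

text \<open>The positive part of \<open>x\<close> is supported on the vertices of \<open>?H\<close>
  and has Rayleigh quotient \<open>c\<close>, so the radius of this \<open>F\<close>-free graph
  reaches the extremal value.\<close>

lemma extremal_graph_positive_part:
  assumes G: "pair_graph G" and F: "free_of F G"
    and m: "0 < m" "m \<le> card (pverts G)"
    and x: "\<And>u. u \<in> pverts G \<Longrightarrow> adj_apply G x u = c * x u"
    and pos: "\<exists>v\<in>pverts G. x v > 0"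
    and card: "card {v \<in> pverts G. x v > 0} = m"
    and c: "c = max_spectral_radius m F"
  shows "extremal_graph m F (induced_pgraph G {v \<in> pverts G. x v > 0})"
proof -
  let ?P = "{v \<in> pverts G. x v > 0}"
  let ?H = "induced_pgraph G ?P"
  let ?p = "\<lambda>v. max (x v) 0"
  have form: "adj_form G ?p = c * inner_on (pverts G) ?p ?p"
    using eigenvalue_le_via_small_positive_part(2)[OF G F m x pos _ c] card by simp
  have H: "pair_graph ?H" using pair_graph_induced[OF G] by auto
  have FH: "free_of F ?H" by (rule free_of_subgraph[OF F]) auto
  obtain v where v: "v \<in> pverts G" "x v > 0" using pos by blast
  have pp: "inner_on (pverts G) ?p ?p > 0"
    by (rule inner_on_self_pos[OF pair_graph_finite[OF G] v(1)]) (use v(2) in auto)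
  have sub: "adj_form ?H ?p = adj_form G ?p" "inner_on ?P ?p ?p = inner_on (pverts G) ?p ?p"
    by (rule adj_form_subgraph[OF G, of ?P ?H]; auto)+
  have "c \<le> graph_spectral_radius ?H"
    by (rule spectral_radius_ge[OF H, of _ ?p]) (use form pp sub in auto)
  moreover have "graph_spectral_radius ?H \<le> max_spectral_radius m F"
    using spectral_radius_le_max[OF H _ m(1) FH] card by simp
  ultimately show ?thesis using H FH card c by (simp add: extremal_graph_def)
qed

section \<open>Graphs in the joining family\<close>

lemma join_family_of_partition:
  assumes G: "pair_graph G" and conn: "Digraph_Component.connected (with_proj G)"
    and V: "pverts G = insert w (P \<union> N)" and w: "w \<notin> P \<union> N"
    and PN: "\<And>u v. u \<in> P \<Longrightarrow> v \<in> N \<Longrightarrow> (u, v) \<notin> parcs G"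
  shows "G \<in> join_family (induced_pgraph G P) (induced_pgraph G N)"
proof -
  \<comment> \<open>The attachment sets are the neighbours of \<open>w\<close> in the two sides.
    With no loop at \<open>w\<close> and no arc between the sides, they account for all arcs not
    inside a side.\<close>
  define S where "S = {v \<in> P. (w, v) \<in> parcs G}"
  define T where "T = {v \<in> N. (w, v) \<in> parcs G}"
  have E: "parcs G = (parcs G \<inter> P \<times> P) \<union> (parcs G \<inter> N \<times> N) \<union> {w} \<times> (S \<union> T) \<union> (S \<union> T) \<times> {w}"
    (is "_ = ?E")
  proof
    show "parcs G \<subseteq> ?E"
    proof
      fix e assume e: "e \<in> parcs G"
      obtain u v where uv: "e = (u, v)" by (cases e)
      have "u \<in> insert w (P \<union> N)" "v \<in> insert w (P \<union> N)"
        using pair_graph_arcD[OF G] e V by (auto simp: uv)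
      moreover have "(w, w) \<notin> parcs G" by (rule pair_graph_no_loop[OF G])
      moreover have "(v, u) \<in> parcs G" using e pair_graph_sym[OF G] by (auto simp: uv)
      ultimately show "e \<in> ?E" using e PN unfolding uv S_def T_def by blast
    qed
    show "?E \<subseteq> parcs G" using pair_graph_sym[OF G] by (auto simp: S_def T_def)
  qed
  have ST: "S \<subseteq> P" "T \<subseteq> N" by (auto simp: S_def T_def)
  show ?thesis
    unfolding join_family_def mem_Collect_eq induced_pgraph_simps
    by (rule conjI, rule exI[of _ w], rule exI[of _ S], rule exI[of _ T], intro conjI)
       (fact w ST V E conn)+
qed

text \<open>Top test functions of the two sides, extended by zero, are orthogonal for the inner
  product and for the form. Their two-dimensional span contains a nonzero \<open>h\<close>
  orthogonal to \<open>\<phi> 0\<close>, whose Rayleigh quotient lies between the smaller radius and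
  the second eigenvalue.\<close>

lemma second_eigenvalue_join_family_ge:
  assumes G: "pair_graph G" and J: "G \<in> join_family A B"
    and A: "pair_graph A" "pverts A \<noteq> {}" and B: "pair_graph B" "pverts B \<noteq> {}"
    and disj: "pverts A \<inter> pverts B = {}"
  shows "min (graph_spectral_radius A) (graph_spectral_radius B) \<le> adj_eigenvalue 2 G"
proof -
  let ?V = "pverts G"
  obtain w S T where w: "w \<notin> pverts A \<union> pverts B" "S \<subseteq> pverts A" "T \<subseteq> pverts B"
    "?V = insert w (pverts A \<union> pverts B)"
    "parcs G = parcs A \<union> parcs B \<union> {w} \<times> (S \<union> T) \<union> (S \<union> T) \<times> {w}"
    using J unfolding join_family_def by blast
  note fin = pair_graph_finite[OF G]
  define r where "r = min (graph_spectral_radius A) (graph_spectral_radius B)"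
  have arcs: "parcs A \<subseteq> pverts A \<times> pverts A" "parcs B \<subseteq> pverts B \<times> pverts B"
    using pair_graph_arcD[OF A(1)] pair_graph_arcD[OF B(1)] by auto
  have indA: "parcs A = parcs G \<inter> pverts A \<times> pverts A"
    and indB: "parcs B = parcs G \<inter> pverts B \<times> pverts B"
    unfolding w(5) using w(1) disj arcs by blast+
  have sub: "pverts A \<subseteq> ?V" "pverts B \<subseteq> ?V" using w(4) by auto
  obtain f0 where f0: "inner_on (pverts A) f0 f0 = 1" "adj_form A f0 = graph_spectral_radius A"
    using spectral_radius_attained[OF A] .
  obtain g0 where g0: "inner_on (pverts B) g0 g0 = 1" "adj_form B g0 = graph_spectral_radius B"
    using spectral_radius_attained[OF B] .
  define f where "f v = (if v \<in> pverts A then f0 v else 0)" for v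
  define g where "g v = (if v \<in> pverts B then g0 v else 0)" for v
  have ff: "inner_on ?V f f = 1" "adj_form G f = graph_spectral_radius A"
  proof -
    have "adj_form A f = adj_form A f0" "inner_on (pverts A) f f = inner_on (pverts A) f0 f0"
      unfolding adj_form_altdef inner_on_def by (auto simp: f_def intro!: sum.cong)
    thus "inner_on ?V f f = 1" "adj_form G f = graph_spectral_radius A"
      using f0 adj_form_subgraph[OF G sub(1) refl indA, of f] by (auto simp: f_def)
  qed
  have gg: "inner_on ?V g g = 1" "adj_form G g = graph_spectral_radius B"
  proof -
    have "adj_form B g = adj_form B g0" "inner_on (pverts B) g g = inner_on (pverts B) g0 g0"
      unfolding adj_form_altdef inner_on_def by (auto simp: g_def intro!: sum.cong)
    thus "inner_on ?V g g = 1" "adj_form G g = graph_spectral_radius B"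
      using g0 adj_form_subgraph[OF G sub(2) refl indB, of g] by (auto simp: g_def)
  qed
  have fg: "inner_on ?V f g = 0"
    unfolding inner_on_def using disj by (intro sum.neutral) (auto simp: f_def g_def)
  have fAg: "inner_on ?V f (adj_apply G g) = 0"
  proof -
    \<comment> \<open>Every arc added to those of \<open>A\<close> and \<open>B\<close> has
      \<open>w\<close> as an end.\<close>
    have no_arc: "(u, v) \<notin> parcs G" if "u \<in> pverts A" "v \<in> pverts B" for u v
      using that w(1,5) disj arcs by blast
    show ?thesis
      unfolding inner_on_def adj_apply_def
      by (intro sum.neutral ballI) (auto simp: f_def g_def no_arc intro!: sum.neutral)
  qed
  obtain \<phi> where "adj_eigenbasis G \<phi>" using adj_eigenbasis_exists[OF G] .
  then interpret adj_eigenbasis G \<phi> .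
  \<comment> \<open>The single linear condition \<open>coef h 0 = 0\<close> has a nonzero solution;
    if the coefficient of \<open>f\<close> already vanishes, \<open>f\<close> itself serves.\<close>
  obtain a b where ab: "a * coef f 0 + b * coef g 0 = 0" "(a, b) \<noteq> (0, 0)"
  proof (cases "coef f 0 = 0")
    case True
    thus ?thesis using that[of 1 0] by simp
  next
    case False
    thus ?thesis using that[of "coef g 0" "- coef f 0"] by simp
  qed
  define h where "h v = a * f v + b * g v" for v
  have hh: "inner_on ?V h h = a\<^sup>2 + b\<^sup>2"
    unfolding h_def inner_on_linear using ff gg fg inner_on_commute[of ?V g f] by (simp add: power2_eq_square)
  have "adj_form G h = a\<^sup>2 * adj_form G f + b\<^sup>2 * adj_form G g"
    unfolding h_def adj_form_def adj_apply_add adj_apply_scale inner_on_linear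
    using fAg adj_apply_self_adjoint[OF G, of g f] inner_on_commute[of ?V f "adj_apply G g"]
    by (simp add: power2_eq_square)
  also have "\<dots> = a\<^sup>2 * graph_spectral_radius A + b\<^sup>2 * graph_spectral_radius B"
    using ff gg by simp
  also have "\<dots> \<ge> a\<^sup>2 * r + b\<^sup>2 * r"
    by (intro add_mono mult_left_mono) (auto simp: r_def)
  finally have low: "r * inner_on ?V h h \<le> adj_form G h" by (simp add: hh algebra_simps)
  have "1 < n"
  proof -
    obtain u where u: "u \<in> pverts A" using A(2) by blast
    have "card {u, w} \<le> card ?V" by (rule card_mono[OF fin]) (use u w(4) in auto)
    moreover have "u \<noteq> w" using u w(1) by auto
    ultimately show ?thesis by simp
  qed
  moreover have "coef h 0 = 0" unfolding h_def inner_on_linear by (rule ab(1))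
  ultimately have "adj_form G h \<le> adj_eigenvalue (Suc 1) G * inner_on ?V h h"
    by (intro adj_form_le) auto
  with low have "r * inner_on ?V h h \<le> adj_eigenvalue 2 G * inner_on ?V h h" by (simp add: numeral_2_eq_2)
  moreover have "inner_on ?V h h > 0" using ab(2) by (auto simp: hh sum_power2_gt_zero_iff)
  ultimately show ?thesis by (simp add: r_def[symmetric])
qed

theorem theorem3p1:
  fixes F :: "'b pair_pre_digraph" and G :: "'a pair_pre_digraph" and n n\<^sub>F :: nat
  assumes "pair_graph F"
    and "pair_graph G"
    and "free_of F G"
    and "Digraph_Component.connected (with_proj G)"
    and "card (pverts G) = n"
    and "n\<^sub>F \<ge> 1"
    and "odd n"
    and "n > 2 * n\<^sub>F"
  shows "adj_eigenvalue 2 G \<le> max_spectral_radius ((n - 1) div 2) F \<and>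
    (adj_eigenvalue 2 G = max_spectral_radius ((n - 1) div 2) F \<longleftrightarrow>
      (\<exists>A B :: 'a pair_pre_digraph.
         extremal_graph ((n - 1) div 2) F A \<and> extremal_graph ((n - 1) div 2) F B \<and>
         pverts A \<inter> pverts B = {} \<and> G \<in> join_family A B) \<and>
      free_of F G)"
proof -
  note G = assms(2) and F = assms(3) and conn = assms(4)
  define m where "m = (n - 1) div 2"
  \<comment> \<open>From \<open>n\<^sub>F \<ge> 1\<close> and \<open>n > 2 * n\<^sub>F\<close>
    follows \<open>0 < m\<close>, so there are at least three vertices and the second eigenvalue is
    meaningful.\<close>
  have nm: "card (pverts G) = 2 * m + 1" and m: "0 < m"
    using assms(5-8) unfolding m_def by presburger+
  have m': "m \<le> card (pverts G)" and two: "2 \<le> card (pverts G)" using nm m by auto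
  note fin = pair_graph_finite[OF G]
  let ?M = "max_spectral_radius m F" and ?c = "adj_eigenvalue 2 G"
  \<comment> \<open>Positive and negative vertices form disjoint sets among \<open>2 * m + 1\<close>
    vertices, so one of them has at most \<open>m\<close> elements; the sign of the eigenfunction is
    chosen to make it the positive one.\<close>
  obtain x where x: "\<And>u. u \<in> pverts G \<Longrightarrow> adj_apply G x u = ?c * x u"
    and pos: "\<exists>v\<in>pverts G. x v > 0" and neg: "\<exists>v\<in>pverts G. x v < 0"
    and small: "card {v \<in> pverts G. x v > 0} \<le> m"
  proof -
    obtain y where y: "\<And>u. u \<in> pverts G \<Longrightarrow> adj_apply G y u = ?c * y u"
      "\<exists>v\<in>pverts G. y v > 0" "\<exists>v\<in>pverts G. y v < 0"
      using second_eigenfunction[OF G conn two] by blast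
    have "card {v \<in> pverts G. y v > 0} + card {v \<in> pverts G. y v < 0}
        = card ({v \<in> pverts G. y v > 0} \<union> {v \<in> pverts G. y v < 0})"
      using fin by (intro card_Un_disjoint[symmetric]) auto
    also have "\<dots> \<le> 2 * m + 1" unfolding nm[symmetric] using fin by (intro card_mono) auto
    finally consider "card {v \<in> pverts G. y v > 0} \<le> m" | "card {v \<in> pverts G. y v < 0} \<le> m"
      by linarith
    thus ?thesis
    proof cases
      case 1
      thus ?thesis using that y by blast
    next
      case 2
      have "adj_apply G (\<lambda>v. - y v) u = ?c * - y u" if "u \<in> pverts G" for u
        using adj_apply_scale[of G "-1" y u] y(1)[OF that] by simp
      thus ?thesis using that[of "\<lambda>v. - y v"] y 2 by simp
    qed
  qed
  have le: "?c \<le> ?M"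
    by (rule eigenvalue_le_via_small_positive_part(1)[OF G F m m' x pos small])
  have "\<exists>A B :: 'a pair_pre_digraph. extremal_graph m F A \<and> extremal_graph m F B \<and>
      pverts A \<inter> pverts B = {} \<and> G \<in> join_family A B" if c: "?c = ?M"
  proof -
    define P where "P = {v \<in> pverts G. x v > 0}"
    define N where "N = {v \<in> pverts G. x v < 0}"
    define Z where "Z = {v \<in> pverts G. x v = 0}"
    have finPNZ: "finite P" "finite N" "finite Z" using fin by (auto simp: P_def N_def Z_def)
    have V: "pverts G = P \<union> N \<union> Z" by (auto simp: P_def N_def Z_def)
    have disj: "P \<inter> N = {}" "(P \<union> N) \<inter> Z = {}" by (auto simp: P_def N_def Z_def)
    have sum: "card P + card N + card Z = 2 * m + 1"
      using finPNZ disj nm by (simp add: V card_Un_disjoint)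
    \<comment> \<open>A zero of \<open>x\<close> beside the \<open>m\<close> positive vertices
      leaves at most \<open>m\<close> negative ones, so \<open>positive_part_card\<close> also
      applies to \<open>y\<close>, the negative of \<open>x\<close>. Then exactly one zero remains,
      the joining vertex.\<close>
    have cardP: "card P = m" and "Z \<noteq> {}"
      using positive_part_card[OF G F conn m m' x pos neg small c] by (auto simp: P_def Z_def)
    hence "0 < card Z" using finPNZ by (simp add: card_gt_0_iff)
    hence smallN: "card N \<le> m" using sum cardP by linarith
    define y where "y v = - x v" for v
    have y: "adj_apply G y u = ?c * y u" if "u \<in> pverts G" for u
      using adj_apply_scale[of G "-1" x u] x[OF that] by (simp add: y_def[abs_def])
    have posy: "\<exists>v\<in>pverts G. y v > 0" and negy: "\<exists>v\<in>pverts G. y v < 0"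
      using pos neg by (auto simp: y_def)
    have N: "N = {v \<in> pverts G. y v > 0}" by (auto simp: N_def y_def)
    have cardN: "card N = m"
      using positive_part_card(1)[OF G F conn m m' y posy negy _ c] smallN unfolding N by simp
    hence "card Z = 1" using sum cardP by simp
    then obtain w where w: "Z = {w}" by (auto simp: card_1_singleton_iff)
    have "(u, v) \<notin> parcs G" if "u \<in> P" "v \<in> N" for u v
      using eigenvalue_le_via_small_positive_part(3)[OF G F m m' x pos small c, of u v] that
      by (auto simp: P_def N_def)
    hence "G \<in> join_family (induced_pgraph G P) (induced_pgraph G N)"
      using V disj w by (intro join_family_of_partition[OF G conn, of w]) auto
    moreover have "extremal_graph m F (induced_pgraph G P)"
      using extremal_graph_positive_part[OF G F m m' x pos _ c] cardP by (simp add: P_def)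
    moreover have "extremal_graph m F (induced_pgraph G N)"
      using extremal_graph_positive_part[OF G F m m' y posy _ c] cardN by (simp add: N)
    ultimately show ?thesis using disj(1) by (intro exI[of _ "induced_pgraph G P"] exI[of _ "induced_pgraph G N"]) simp
  qed
  \<comment> \<open>Both sides have the extremal radius, so the lower bound for joins meets the
    upper bound \<open>le\<close>.\<close>
  moreover have "?c = ?M" if "extremal_graph m F A" "extremal_graph m F B"
    "pverts A \<inter> pverts B = {}" "G \<in> join_family A B" for A B :: "'a pair_pre_digraph"
  proof -
    have AB: "pair_graph A" "pair_graph B" "graph_spectral_radius A = ?M" "graph_spectral_radius B = ?M"
      "pverts A \<noteq> {}" "pverts B \<noteq> {}"
      using that(1,2) m by (auto simp: extremal_graph_def)
    have "?M \<le> ?c"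
      using second_eigenvalue_join_family_ge[OF G that(4) AB(1,5) AB(2,6) that(3)] AB(3,4) by simp
    with le show ?thesis by simp
  qed
  ultimately show ?thesis using le F unfolding m_def by blast
qed

end
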